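(* Let $\mathbf{A} \in \mathbb{R}^{m \times n}$ be a matrix with non-negative entries, let $q \geq p \geq 1$ be reals, let $0 < \epsilon \leq \frac{1}{2q}$, and let $V \geq 0$ be a guess for $\|\mathbf{A}\|_{q \to p}$. Then the algorithm described below (run on input $\mathbf{A}, V, \epsilon, q, p$) either returns a vector $\mathbf{x}$ such that $$\frac{\|\mathbf{A}\mathbf{x}\|_p}{\|\mathbf{x}\|_q} \geq (1-\epsilon)V,$$ or certifies infeasibility (i.e. correctly reports that $\|\mathbf{A}\|_{q\to p} < V$), and it runs in time $$O\left(\frac{1}{q\epsilon}\log\left(\frac{n}{q\epsilon}\right)\left(\mathrm{nnz}(\mathbf{A}) + m\log p\right)\right).$$
   Context: For a vector $\mathbf{z}$, $\|\mathbf{z}\|_p = (\sum_i |\mathbf{z}_i|^p)^{1/p}$, and for a matrix $\mathbf{A}\in\mathbb{R}^{m\times n}$, $\|\mathbf{A}\|_{q\to p} = \max_{\mathbf{z}\neq \mathbf{0}} \|\mathbf{A}\mathbf{z}\|_p/\|\mathbf{z}\|_q$. $\mathrm{nnz}(\mathbf{A})$ is the number of nonzero entries of $\mathbf{A}$, $\mathbf{A}_{\cdot,k}$ is its $k$-th column, and powers of vectors are taken coordinatewise. For a positive vector $\mathbf{x}\in\mathbb{R}^n$, the potential vector $\mathbf{\Phi}(\mathbf{x})\in\mathbb{R}^n$ is defined by $$\mathbf{\Phi}(\mathbf{x})_k = \|\mathbf{A}\mathbf{x}\|_p^{q-p}\,\frac{\langle \mathbf{A}_{\cdot,k}, (\mathbf{A}\mathbf{x})^{p-1}\rangle}{\mathbf{x}_k^{q-1}}.$$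 The algorithm: initialize $\mathbf{x} \leftarrow n^{-1/q}\mathbf{1}$ and $\alpha \leftarrow \epsilon/8$. While $\|\mathbf{A}\mathbf{x}\|_p/\|\mathbf{x}\|_q < (1-\epsilon)V$: set $\boldsymbol{\delta}_i \leftarrow \alpha \mathbf{x}_i$ if $\mathbf{\Phi}(\mathbf{x})_i \geq ((1-\epsilon/4)V)^q$ and $\boldsymbol{\delta}_i \leftarrow 0$ otherwise; update $\mathbf{x} \leftarrow \mathbf{x}+\boldsymbol{\delta}$; if $\mathbf{\Phi}(\mathbf{x})_i < V^q$ for all $i$, return "infeasible". When the loop ends, return $\mathbf{x}$.
   Formalization: The running-time bound is stated as O(max(1, bound)), because for A = 0 and p = 1 the literal bound is 0, which no algorithm meets; for A ≠ 0 the maximum is the bound itself. Also m, n ≥ 1 is assumed. *)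

theory Defs
  imports
    Complex_Main
    "Jordan_Normal_Form.Matrix"
    "HOL-Library.While_Combinator"
    "HOL-Library.Monad_Syntax"
begin

section \<open>Norms and sparsity\<close>

definition pnorm :: "real \<Rightarrow> real vec \<Rightarrow> real" where
  "pnorm p z = (\<Sum>i<dim_vec z. \<bar>z $ i\<bar> powr p) powr (1 / p)"

definition op_norm :: "real \<Rightarrow> real \<Rightarrow> real mat \<Rightarrow> real" where
  "op_norm q p A = Sup {pnorm p (A *\<^sub>v z) / pnorm q z | z.
     z \<in> carrier_vec (dim_col A) \<and> z \<noteq> 0\<^sub>v (dim_col A)}"

definition nnz :: "real mat \<Rightarrow> nat" where
  "nnz A = card {(i, j). i < dim_row A \<and> j < dim_col A \<and> A $$ (i, j) \<noteq> 0}"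

definition vec_powr :: "real vec \<Rightarrow> real \<Rightarrow> real vec" where
  "vec_powr z r = map_vec (\<lambda>a. a powr r) z"


section \<open>The algorithm\<close>

text \<open>
  In Isabelle \<^prop>\<open>(0::real) powr 0 = 0\<close>. This does not affect the potential: if \<open>A\<close> is
  non-negative and \<open>x\<close> is positive, then \<open>(A x)\<^sub>i = 0\<close> only if row \<open>i\<close> of \<open>A\<close> vanishes, and
  then the factor \<open>A\<^sub>i\<^sub>k\<close> is zero as well; likewise \<open>\<parallel>A x\<parallel>\<^sub>p = 0\<close> only if \<open>A = 0\<close>.
\<close>

definition potential :: "real \<Rightarrow> real \<Rightarrow> real mat \<Rightarrow> real vec \<Rightarrow> real vec" where
  "potential q p A x = vec (dim_col A) (\<lambda>k.
     pnorm p (A *\<^sub>v x) powr (q - p) *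
     ((col A k \<bullet> vec_powr (A *\<^sub>v x) (p - 1)) / (x $ k) powr (q - 1)))"

datatype outcome = Infeasible | Returned "real vec"

definition delta :: "real mat \<Rightarrow> real \<Rightarrow> real \<Rightarrow> real \<Rightarrow> real \<Rightarrow> real vec \<Rightarrow> real vec" where
  "delta A V \<epsilon> q p x = vec (dim_col A) (\<lambda>i.
     if potential q p A x $ i \<ge> ((1 - \<epsilon> / 4) * V) powr q then (\<epsilon> / 8) * x $ i else 0)"

text \<open>
  The loop state consists of the current vector and a flag recording that the loop has been left
  through ``infeasible''. The value \<open>None\<close> means non-termination.
\<close>

definition norm_alg :: "real mat \<Rightarrow> real \<Rightarrow> real \<Rightarrow> real \<Rightarrow> real \<Rightarrow> outcome option" where
  "norm_alg A V \<epsilon> q p =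
     map_option (\<lambda>(x, infeasible). if infeasible then Infeasible else Returned x)
       (while_option
          (\<lambda>(x, infeasible).
             \<not> infeasible \<and> pnorm p (A *\<^sub>v x) / pnorm q x < (1 - \<epsilon>) * V)
          (\<lambda>(x, _).
             let x' = x + delta A V \<epsilon> q p x
             in (x', \<forall>i<dim_col A. potential q p A x' $ i < V powr q))
          (vec (dim_col A) (\<lambda>_. real (dim_col A) powr (- 1 / q)), False))"


section \<open>Cost model\<close>

text \<open>
  A real RAM. Every arithmetic operation, comparison, array access, loop test and loop iteration
  costs one unit. A power \<open>a\<^sup>r\<close> that is taken for each entry of a vector is charged the
  \<open>O(log r)\<close> multiplications of repeated squaring; this is what produces the term \<open>m log p\<close>.
  The remaining powers, of which there is a constant number per iteration (with exponents
  depending on \<open>q\<close>), cost one unit. An array is created with a default value in one unit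
  (constant-time initialisation).
\<close>

datatype 'a timed = Timed (val: 'a) (time: nat)

definition returnT :: "'a \<Rightarrow> 'a timed" where
  "returnT a = Timed a 0"

definition bindT :: "'a timed \<Rightarrow> ('a \<Rightarrow> 'b timed) \<Rightarrow> 'b timed" where
  "bindT M f = Timed (val (f (val M))) (time M + time (f (val M)))"

adhoc_overloading Monad_Syntax.bind \<rightleftharpoons> bindT

definition addT :: "real \<Rightarrow> real \<Rightarrow> real timed" where "addT a b = Timed (a + b) 1"
definition subT :: "real \<Rightarrow> real \<Rightarrow> real timed" where "subT a b = Timed (a - b) 1"
definition mulT :: "real \<Rightarrow> real \<Rightarrow> real timed" where "mulT a b = Timed (a * b) 1"
definition divT :: "real \<Rightarrow> real \<Rightarrow> real timed" where "divT a b = Timed (a / b) 1"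
definition lessT :: "real \<Rightarrow> real \<Rightarrow> bool timed" where "lessT a b = Timed (a < b) 1"
definition leT :: "real \<Rightarrow> real \<Rightarrow> bool timed" where "leT a b = Timed (a \<le> b) 1"
definition andT :: "bool \<Rightarrow> bool \<Rightarrow> bool timed" where "andT a b = Timed (a \<and> b) 1"
definition notT :: "bool \<Rightarrow> bool timed" where "notT a = Timed (\<not> a) 1"

definition scalar_powT :: "real \<Rightarrow> real \<Rightarrow> real timed" where
  "scalar_powT a r = Timed (a powr r) 1"

definition entry_powT :: "real \<Rightarrow> real \<Rightarrow> real timed" where
  "entry_powT a r = Timed (a powr r) (1 + nat \<lceil>log 2 (1 + r)\<rceil>)"

definition newT :: "nat \<Rightarrow> real \<Rightarrow> real vec timed" where
  "newT k a = Timed (vec k (\<lambda>_. a)) 1"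

definition readT :: "real vec \<Rightarrow> nat \<Rightarrow> real timed" where
  "readT z i = Timed (z $ i) 1"

definition writeT :: "real vec \<Rightarrow> nat \<Rightarrow> real \<Rightarrow> real vec timed" where
  "writeT z i a = Timed (vec (dim_vec z) (\<lambda>j. if j = i then a else z $ j)) 1"

fun forT :: "'a list \<Rightarrow> ('a \<Rightarrow> 's \<Rightarrow> 's timed) \<Rightarrow> 's \<Rightarrow> 's timed" where
  "forT [] f s = Timed s 1"
| "forT (a # as) f s = do { _ \<leftarrow> Timed () 1; s' \<leftarrow> f a s; forT as f s' }"

definition whileT :: "('s \<Rightarrow> bool timed) \<Rightarrow> ('s \<Rightarrow> 's timed) \<Rightarrow> 's timed \<Rightarrow> 's timed option" where
  "whileT b c s0 =
     map_option (\<lambda>S. Timed (val S) (time S + time (b (val S))))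
       (while_option
          (\<lambda>S. val (b (val S)))
          (\<lambda>S. Timed (val (c (val S))) (time S + time (b (val S)) + time (c (val S))))
          s0)"


section \<open>Implementation on sparse matrices\<close>

text \<open>
  The input matrix is stored both by rows and by columns. Only the nonzero entries, and only the
  rows (columns) containing one, are listed.
\<close>

type_synonym sparse = "(nat \<times> (nat \<times> real) list) list"

definition row_entries :: "real mat \<Rightarrow> nat \<Rightarrow> (nat \<times> real) list" where
  "row_entries A i =
     map (\<lambda>j. (j, A $$ (i, j))) (filter (\<lambda>j. A $$ (i, j) \<noteq> 0) [0..<dim_col A])"

definition sparse_rows :: "real mat \<Rightarrow> sparse" where
  "sparse_rows A =
     map (\<lambda>i. (i, row_entries A i)) (filter (\<lambda>i. row_entries A i \<noteq> []) [0..<dim_row A])"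

definition sparse_cols :: "real mat \<Rightarrow> sparse" where
  "sparse_cols A = sparse_rows (transpose_mat A)"

definition dotT :: "(nat \<times> real) list \<Rightarrow> real vec \<Rightarrow> real timed" where
  "dotT es z = forT es (\<lambda>(j, a) s. do { b \<leftarrow> readT z j; c \<leftarrow> mulT a b; addT s c }) 0"

definition mat_vecT :: "nat \<Rightarrow> sparse \<Rightarrow> real vec \<Rightarrow> real vec timed" where
  "mat_vecT m rs x = do {
     y \<leftarrow> newT m 0;
     forT rs (\<lambda>(i, es) y. do { s \<leftarrow> dotT es x; writeT y i s }) y
   }"

text \<open>\<open>y\<close> is non-negative and vanishes outside the rows listed in \<open>rs\<close>.\<close>

definition pnormT :: "real \<Rightarrow> sparse \<Rightarrow> real vec \<Rightarrow> real timed" where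
  "pnormT p rs y = do {
     s \<leftarrow> forT rs (\<lambda>(i, _) s. do { a \<leftarrow> readT y i; b \<leftarrow> entry_powT a p; addT s b }) 0;
     r \<leftarrow> divT 1 p;
     scalar_powT s r
   }"

text \<open>\<open>u\<close> holds the coordinates of \<open>x\<^sup>q\<^sup>-\<^sup>1\<close>.\<close>

definition potentialT ::
  "nat \<Rightarrow> nat \<Rightarrow> sparse \<Rightarrow> sparse \<Rightarrow> real \<Rightarrow> real \<Rightarrow> real vec \<Rightarrow> real vec \<Rightarrow> real vec timed" where
  "potentialT m n rs cs q p x u = do {
     y \<leftarrow> mat_vecT m rs x;
     N \<leftarrow> pnormT p rs y;
     d \<leftarrow> subT q p;
     c \<leftarrow> scalar_powT N d;
     e \<leftarrow> subT p 1;
     w \<leftarrow> newT m 0;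
     w \<leftarrow> forT rs (\<lambda>(i, _) w. do { a \<leftarrow> readT y i; b \<leftarrow> entry_powT a e; writeT w i b }) w;
     f \<leftarrow> newT n 0;
     forT cs (\<lambda>(k, es) f. do {
       g \<leftarrow> dotT es w;
       v \<leftarrow> readT u k;
       h \<leftarrow> divT g v;
       t \<leftarrow> mulT c h;
       writeT f k t
     }) f
   }"

text \<open>
  The loop state is \<open>(x, u, D, infeasible)\<close>. The implementation never takes powers of the entries
  of \<open>x\<close>: the vector \<open>u = x\<^sup>q\<^sup>-\<^sup>1\<close> and the number \<open>D = \<parallel>x\<parallel>\<^sub>q\<^sup>q\<close> are maintained by
  multiplication with the precomputed powers \<open>\<beta> = (1 + \<alpha>)\<^sup>q\<^sup>-\<^sup>1\<close> and \<open>\<gamma> = (1 + \<alpha>)\<^sup>q - 1\<close>.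
\<close>

type_synonym state = "real vec \<times> real vec \<times> real \<times> bool"

definition condT :: "nat \<Rightarrow> sparse \<Rightarrow> real \<Rightarrow> real \<Rightarrow> real \<Rightarrow> state \<Rightarrow> bool timed" where
  "condT m rs q p target = (\<lambda>(x, u, D, infeasible). do {
     y \<leftarrow> mat_vecT m rs x;
     a \<leftarrow> pnormT p rs y;
     r \<leftarrow> divT 1 q;
     b \<leftarrow> scalar_powT D r;
     c \<leftarrow> divT a b;
     l \<leftarrow> lessT c target;
     k \<leftarrow> notT infeasible;
     andT k l
   })"

definition updateT ::
  "sparse \<Rightarrow> real \<Rightarrow> real \<Rightarrow> real \<Rightarrow> real \<Rightarrow> real vec \<Rightarrow>
   real vec \<times> real vec \<times> real \<Rightarrow> (real vec \<times> real vec \<times> real) timed" where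
  "updateT cs \<alpha> \<beta> \<gamma> thr f = forT cs (\<lambda>(k, _) (x, u, D). do {
     \<phi> \<leftarrow> readT f k;
     b \<leftarrow> leT thr \<phi>;
     if b then do {
       a \<leftarrow> readT x k;
       v \<leftarrow> readT u k;
       \<delta> \<leftarrow> mulT \<alpha> a;
       a' \<leftarrow> addT a \<delta>;
       v' \<leftarrow> mulT \<beta> v;
       e \<leftarrow> mulT a v;
       e' \<leftarrow> mulT \<gamma> e;
       D' \<leftarrow> addT D e';
       x' \<leftarrow> writeT x k a';
       u' \<leftarrow> writeT u k v';
       returnT (x', u', D')
     } else returnT (x, u, D)
   })"

definition infeasibleT :: "sparse \<Rightarrow> real \<Rightarrow> real vec \<Rightarrow> bool timed" where
  "infeasibleT cs W f =
     forT cs (\<lambda>(k, _) b. do { \<phi> \<leftarrow> readT f k; l \<leftarrow> lessT \<phi> W; andT b l }) True"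

definition bodyT ::
  "nat \<Rightarrow> nat \<Rightarrow> sparse \<Rightarrow> sparse \<Rightarrow> real \<Rightarrow> real \<Rightarrow> real \<Rightarrow> real \<Rightarrow> real \<Rightarrow> real \<Rightarrow> real \<Rightarrow>
   state \<Rightarrow> state timed" where
  "bodyT m n rs cs q p \<alpha> \<beta> \<gamma> thr W = (\<lambda>(x, u, D, _). do {
     f \<leftarrow> potentialT m n rs cs q p x u;
     (x', u', D') \<leftarrow> updateT cs \<alpha> \<beta> \<gamma> thr f (x, u, D);
     f' \<leftarrow> potentialT m n rs cs q p x' u';
     b \<leftarrow> infeasibleT cs W f';
     returnT (x', u', D', b)
   })"

definition setupT ::
  "nat \<Rightarrow> real \<Rightarrow> real \<Rightarrow> real \<Rightarrow>
   (real \<times> real \<times> real \<times> real \<times> real \<times> real \<times> real vec \<times> real vec) timed" where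
  "setupT n V \<epsilon> q = do {
     \<alpha> \<leftarrow> divT \<epsilon> 8;
     a \<leftarrow> addT 1 \<alpha>;
     r \<leftarrow> subT q 1;
     \<beta> \<leftarrow> scalar_powT a r;
     b \<leftarrow> scalar_powT a q;
     \<gamma> \<leftarrow> subT b 1;
     c \<leftarrow> divT \<epsilon> 4;
     d \<leftarrow> subT 1 c;
     e \<leftarrow> mulT d V;
     thr \<leftarrow> scalar_powT e q;
     W \<leftarrow> scalar_powT V q;
     g \<leftarrow> subT 1 \<epsilon>;
     target \<leftarrow> mulT g V;
     h \<leftarrow> divT (- 1) q;
     x0 \<leftarrow> scalar_powT (real n) h;
     u0 \<leftarrow> scalar_powT x0 r;
     x \<leftarrow> newT n x0;
     u \<leftarrow> newT n u0;
     returnT (\<alpha>, \<beta>, \<gamma>, thr, W, target, x, u)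
   }"

text \<open>The initial vector satisfies \<open>\<parallel>x\<parallel>\<^sub>q = 1\<close>, so \<open>D\<close> starts at \<open>1\<close>.\<close>

definition norm_algT ::
  "real mat \<Rightarrow> real \<Rightarrow> real \<Rightarrow> real \<Rightarrow> real \<Rightarrow> outcome timed option" where
  "norm_algT A V \<epsilon> q p =
     (let m = dim_row A; n = dim_col A; rs = sparse_rows A; cs = sparse_cols A;
          S = setupT n V \<epsilon> q;
          (\<alpha>, \<beta>, \<gamma>, thr, W, target, x, u) = val S
      in map_option
           (\<lambda>R. case val R of (x, _, _, infeasible) \<Rightarrow>
              Timed (if infeasible then Infeasible else Returned x) (time R))
           (whileT (condT m rs q p target) (bodyT m n rs cs q p \<alpha> \<beta> \<gamma> thr W)
              (Timed (x, u, 1, False) (time S))))"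


section \<open>The running-time expression\<close>

text \<open>
  If \<open>A = 0\<close> then the running-time expression can be smaller than one unit (it is \<open>0\<close> for
  \<open>p = 1\<close>), so no algorithm meets it; the theorem therefore uses its maximum with \<open>1\<close>. By the
  following lemma this maximum is the expression itself for all \<open>A \<noteq> 0\<close>.
\<close>

lemma runtime_ge_1:
  assumes A: "A \<in> carrier_mat m n" "A \<noteq> 0\<^sub>m m n"
    and p: "1 \<le> p" "p \<le> q" and eps: "0 < \<epsilon>" "\<epsilon> \<le> 1 / (2 * q)"
  shows "1 \<le> 1 / (q * \<epsilon>) * ln (real n / (q * \<epsilon>)) * (real (nnz A) + real m * ln p)"
proof -
  have "\<exists>i j. i < m \<and> j < n \<and> A $$ (i, j) \<noteq> 0"
    using A by (metis carrier_matD eq_matI index_zero_mat)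
  then obtain i j where ij: "i < m" "j < n" "A $$ (i, j) \<noteq> 0" by blast
  have fin: "finite {(i, j). i < dim_row A \<and> j < dim_col A \<and> A $$ (i, j) \<noteq> 0}"
    by (rule finite_subset[of _ "{..<dim_row A} \<times> {..<dim_col A}"]) auto
  have "{(i, j)} \<subseteq> {(i, j). i < dim_row A \<and> j < dim_col A \<and> A $$ (i, j) \<noteq> 0}"
    using ij A by auto
  from card_mono[OF fin this] have nz: "1 \<le> nnz A" by (simp add: nnz_def)
  have qe: "0 < q * \<epsilon>" "q * \<epsilon> \<le> 1 / 2"
    using p eps by (auto simp: field_simps)
  have a: "2 \<le> 1 / (q * \<epsilon>)" using qe by (simp add: field_simps)
  have "1 / (q * \<epsilon>) \<le> real n / (q * \<epsilon>)"
    using ij A qe by (intro divide_right_mono) auto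
  with a have b0: "2 \<le> real n / (q * \<epsilon>)" by linarith
  hence b: "ln 2 \<le> ln (real n / (q * \<epsilon>))" by simp
  have "exp (1::real) \<le> 2 ^ 2" using exp_le by simp
  hence "1 \<le> ln ((2::real) ^ 2)" by (subst ln_ge_iff) auto
  hence l: "1 \<le> 2 * ln (2::real)" using ln_realpow[of 2 2] by simp
  have "2 * ln 2 \<le> 1 / (q * \<epsilon>) * ln (real n / (q * \<epsilon>))"
    by (rule mult_mono[OF a b]) (use qe in auto)
  with l have c: "1 \<le> 1 / (q * \<epsilon>) * ln (real n / (q * \<epsilon>))" by linarith
  have "0 \<le> real m * ln p" using p by simp
  with nz have d: "1 \<le> real (nnz A) + real m * ln p" by linarith
  from mult_mono[OF c d] c show ?thesis by simp
qed

end

theory Submission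
  imports Defs
begin

text \<open>
  For non-negative \<open>A\<close> and positive \<open>x\<close>, two applications of Jensen's inequality give
  \<open>\<parallel>A z\<parallel>\<^sub>p\<^sup>q \<le> \<Sum>\<^sub>j \<bar>z\<^sub>j\<bar>\<^sup>q \<Phi>(x)\<^sub>j\<close> for every \<open>z\<close>, so \<open>\<Phi>(x) < V\<^sup>q\<close> certifies
  \<open>\<parallel>A\<parallel> < V\<close>. By convexity, a step raises \<open>\<parallel>A x\<parallel>\<^sub>p\<^sup>q\<close> by almost \<open>((1 - \<epsilon>/4) V)\<^sup>q\<close> times the
  increase of \<open>\<parallel>x\<parallel>\<^sub>q\<^sup>q\<close>; hence \<open>\<parallel>x\<parallel>\<^sub>q\<^sup>q = O(1/(q \<epsilon>))\<close> as long as the loop runs. A coordinate with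
  \<open>\<Phi>\<^sub>k \<ge> V\<^sup>q\<close> must have been scaled up in every previous round, because scaled coordinates have
  non-increasing potential and the others stay below \<open>V\<^sup>q\<close>. If the algorithm has not reported
  infeasibility after \<open>T\<close> rounds, such a coordinate exists and contributes
  \<open>(1 + \<epsilon>/8)\<^sup>q\<^sup>T / n\<close> to \<open>\<parallel>x\<parallel>\<^sub>q\<^sup>q\<close>, which bounds \<open>T\<close> by \<open>O(log(n/(q \<epsilon>)) / (q \<epsilon>))\<close>.
\<close>

section \<open>Powers, norms and potentials\<close>

lemma two_ln_2_ge_1: "1 \<le> 2 * ln (2::real)"
proof -
  have "exp (1::real) \<le> 2 ^ 2" using exp_le by simp
  then have "1 \<le> ln ((2::real) ^ 2)" by (subst ln_ge_iff) auto
  then show ?thesis using ln_realpow[of 2 2] by simp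
qed

text \<open>Convexity: the graph of \<open>t powr r\<close> lies above its tangent at
  \<open>s\<close>. For positive arguments this follows from the mean value theorem and the monotone
  derivative; zero arguments are split off because the derivative rule requires positivity.\<close>

lemma powr_tangent:
  fixes s t r :: real
  assumes "0 \<le> s" "0 \<le> t" "1 \<le> r"
  shows "s powr r + r * s powr (r - 1) * (t - s) \<le> t powr r"
proof -
  have *: "s powr r = s * s powr (r - 1)" if "0 \<le> s" for s :: real
    using powr_mult_base[OF that, of "r - 1"] by simp
  consider "s = 0" | "t = 0" | "0 < s" "0 < t" using assms by linarith
  then show ?thesis
  proof cases
    case 1
    \<comment> \<open>\<open>0 powr (r - 1) = 0\<close> also for \<open>r = 1\<close>, so the left
      side is \<open>0\<close>.\<close>
    then show ?thesis by simp
  next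
    case 2
    have "s powr r \<le> r * s powr r" using assms by (simp add: mult_le_cancel_right1)
    then show ?thesis using 2 *[OF \<open>0 \<le> s\<close>] assms by (simp add: algebra_simps)
  next
    case 3
    have der: "((\<lambda>u. u powr r) has_real_derivative r * u powr (r - 1)) (at u)" if "0 < u" for u
      using has_real_derivative_powr[OF that] by simp
    consider "s = t" | "s < t" | "t < s" by linarith
    then show ?thesis
    proof cases
      case 1
      then show ?thesis by simp
    next
      case 2
      obtain z where z: "s < z" "z < t" "t powr r - s powr r = (t - s) * (r * z powr (r - 1))"
        using MVT2[OF 2, of "\<lambda>u. u powr r" "\<lambda>u. r * u powr (r - 1)"] der 3 by auto
      have "s powr (r - 1) \<le> z powr (r - 1)" using z 3 assms by (intro powr_mono2) auto
      then have "(t - s) * (r * s powr (r - 1)) \<le> (t - s) * (r * z powr (r - 1))"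
        using 2 assms by (intro mult_left_mono) auto
      with z show ?thesis by (simp add: algebra_simps)
    next
      case 3
      obtain z where z: "t < z" "z < s" "s powr r - t powr r = (s - t) * (r * z powr (r - 1))"
        using MVT2[OF 3, of "\<lambda>u. u powr r" "\<lambda>u. r * u powr (r - 1)"] der \<open>0 < t\<close> by auto
      have "z powr (r - 1) \<le> s powr (r - 1)" using z \<open>0 < t\<close> assms by (intro powr_mono2) auto
      then have "(s - t) * (r * z powr (r - 1)) \<le> (s - t) * (r * s powr (r - 1))"
        using 3 assms by (intro mult_left_mono) auto
      with z show ?thesis by (simp add: algebra_simps)
    qed
  qed
qed

text \<open>Jensen's inequality with unnormalised weights; for total weight \<open>W > 0\<close> the
  factor \<open>W powr (r - 1)\<close> is \<open>W powr r / W\<close>. Summing the tangent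
  inequality at the weighted mean \<open>s\<close> makes the linear terms cancel.\<close>

lemma powr_weighted_sum_le:
  fixes w t :: "'a \<Rightarrow> real"
  assumes fin: "finite I" and w: "\<And>i. i \<in> I \<Longrightarrow> 0 \<le> w i" and t: "\<And>i. i \<in> I \<Longrightarrow> 0 \<le> t i"
    and r: "1 \<le> r"
  shows "(\<Sum>i\<in>I. w i * t i) powr r \<le> (\<Sum>i\<in>I. w i) powr (r - 1) * (\<Sum>i\<in>I. w i * t i powr r)"
proof (cases "(\<Sum>i\<in>I. w i) = 0")
  case True
  then have "\<forall>i\<in>I. w i = 0" using fin w by (subst (asm) sum_nonneg_eq_0_iff) auto
  then show ?thesis by simp
next
  case False
  define W where "W = (\<Sum>i\<in>I. w i)"
  have W: "0 < W" using False w sum_nonneg[of I w] by (force simp: W_def)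
  define s where "s = (\<Sum>i\<in>I. w i * t i) / W"
  have s0: "0 \<le> s" unfolding s_def using W w t by (intro divide_nonneg_pos sum_nonneg) auto
  have Ws: "(\<Sum>i\<in>I. w i * t i) = W * s" using W by (simp add: s_def)
  have "W * s powr r = (\<Sum>i\<in>I. w i * (s powr r + r * s powr (r - 1) * (t i - s)))"
  proof -
    have "(\<Sum>i\<in>I. w i * (s powr r + r * s powr (r - 1) * (t i - s)))
        = (\<Sum>i\<in>I. w i * (s powr r - r * s powr (r - 1) * s) + r * s powr (r - 1) * (w i * t i))"
      by (simp add: algebra_simps)
    also have "\<dots> = W * (s powr r - r * s powr (r - 1) * s) + r * s powr (r - 1) * (W * s)"
      by (simp add: sum.distrib sum_distrib_left[symmetric] sum_distrib_right[symmetric] Ws W_def[symmetric])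
    finally show ?thesis by (simp add: algebra_simps)
  qed
  also have "\<dots> \<le> (\<Sum>i\<in>I. w i * t i powr r)"
    using w t r s0 by (intro sum_mono mult_left_mono powr_tangent) auto
  finally have "W powr (r - 1) * (W * s powr r) \<le> W powr (r - 1) * (\<Sum>i\<in>I. w i * t i powr r)"
    by (intro mult_left_mono) auto
  moreover have "W powr (r - 1) * (W * s powr r) = (W * s) powr r"
    using W powr_mult_base[of W "r - 1"] by (simp add: powr_mult mult.commute mult.left_commute)
  ultimately show ?thesis by (simp add: Ws W_def)
qed

section \<open>The p-norm, matrix-vector products and the potential\<close>

lemma pnorm_powr:
  assumes "z \<in> carrier_vec k"
  shows "pnorm p z powr r = (\<Sum>i<k. \<bar>z $ i\<bar> powr p) powr (r / p)"
  using assms by (simp add: pnorm_def powr_powr)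

lemma pnorm_nonneg: "0 \<le> pnorm p z"
  by (simp add: pnorm_def)

locale nonneg_matrix =
  fixes A :: "real mat" and m n :: nat and p q :: real
  assumes carrier: "A \<in> carrier_mat m n"
    and nonneg: "\<And>i j. i < m \<Longrightarrow> j < n \<Longrightarrow> 0 \<le> A $$ (i, j)"
    and p1: "1 \<le> p" and pq: "p \<le> q"
begin

lemma dims [simp]: "dim_row A = m" "dim_col A = n"
  using carrier by auto

definition positive :: "real vec \<Rightarrow> bool" where
  "positive x \<longleftrightarrow> x \<in> carrier_vec n \<and> (\<forall>j<n. 0 < x $ j)"

lemma positive_carrier: "positive x \<Longrightarrow> x \<in> carrier_vec n"
  by (simp add: positive_def)

lemma positive_gt_0: "positive x \<Longrightarrow> j < n \<Longrightarrow> 0 < x $ j"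
  by (simp add: positive_def)

lemma mult_mat_vec_index:
  assumes "x \<in> carrier_vec n" "i < m"
  shows "(A *\<^sub>v x) $ i = (\<Sum>j<n. A $$ (i, j) * x $ j)"
  using assms by (simp add: scalar_prod_def lessThan_atLeast0)

lemma mult_mat_vec_carrier: "A *\<^sub>v x \<in> carrier_vec m"
  by (simp add: carrier_vecI)

lemma mult_positive_nonneg:
  assumes "positive x" "i < m"
  shows "0 \<le> (A *\<^sub>v x) $ i"
  unfolding mult_mat_vec_index[OF positive_carrier[OF assms(1)] assms(2)]
  using assms nonneg by (intro sum_nonneg) (auto simp: positive_def less_imp_le)

text \<open>Nonnegative terms with sum 0 vanish one by one, and the entries of \<open>x\<close> are
  positive. So a zero coordinate of \<open>A x\<close> comes only from a zero row, which keeps later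
  divisions by \<open>(A x) $ i\<close> harmless.\<close>

lemma mult_positive_eq_0:
  assumes x: "positive x" and ij: "i < m" "j < n" and 0: "(A *\<^sub>v x) $ i = 0"
  shows "A $$ (i, j) = 0"
proof -
  have "\<forall>j\<in>{..<n}. A $$ (i, j) * x $ j = 0"
    using 0 x ij nonneg unfolding mult_mat_vec_index[OF positive_carrier[OF x] ij(1)]
    by (subst (asm) sum_nonneg_eq_0_iff) (auto simp: positive_def less_imp_le)
  then show ?thesis using positive_gt_0[OF x ij(2)] ij by auto
qed

lemma pnorm_mult_positive_powr:
  assumes "positive x"
  shows "pnorm p (A *\<^sub>v x) powr r = (\<Sum>i<m. (A *\<^sub>v x) $ i powr p) powr (r / p)"
  using mult_positive_nonneg[OF assms] pnorm_powr[OF mult_mat_vec_carrier] by simp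

lemma potential_index:
  assumes "k < n"
  shows "potential q p A x $ k = pnorm p (A *\<^sub>v x) powr (q - p) *
    ((\<Sum>i<m. A $$ (i, k) * (A *\<^sub>v x) $ i powr (p - 1)) / (x $ k) powr (q - 1))"
  using assms by (simp add: potential_def scalar_prod_def vec_powr_def lessThan_atLeast0)

lemma potential_nonneg:
  assumes "positive x" "k < n"
  shows "0 \<le> potential q p A x $ k"
  unfolding potential_index[OF assms(2)] using assms nonneg
  by (intro mult_nonneg_nonneg divide_nonneg_nonneg sum_nonneg) auto

text \<open>Jensen's inequality is used twice: with exponent \<open>q\<close> inside each row, and with exponent
  \<open>q / p\<close> over the rows with weights \<open>(A x)\<^sub>i\<^sup>p\<close>.\<close>

lemma pnorm_mult_le_potential:
  assumes x: "positive x" and z: "z \<in> carrier_vec n"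
  shows "pnorm p (A *\<^sub>v z) powr q \<le> (\<Sum>j<n. \<bar>z $ j\<bar> powr q * potential q p A x $ j)"
proof -
  define y where "y i = (A *\<^sub>v x) $ i" for i
  define b where "b i = (\<Sum>j<n. A $$ (i, j) * \<bar>z $ j\<bar>)" for i
  have y0: "0 \<le> y i" if "i < m" for i using mult_positive_nonneg[OF x that] by (simp add: y_def)
  have b0: "0 \<le> b i" if "i < m" for i
    unfolding b_def using nonneg that by (intro sum_nonneg) auto
  have by0: "b i = 0" if "i < m" "y i = 0" for i
    using mult_positive_eq_0[OF x that(1)] that(2) by (simp add: b_def y_def)
  have xpos: "0 < x $ j" if "j < n" for j using positive_gt_0[OF x that] .
  have q1: "1 \<le> q" using p1 pq by linarith
  have Az: "\<bar>(A *\<^sub>v z) $ i\<bar> \<le> b i" if "i < m" for i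
  proof -
    have "\<bar>(A *\<^sub>v z) $ i\<bar> \<le> (\<Sum>j<n. \<bar>A $$ (i, j) * z $ j\<bar>)"
      unfolding mult_mat_vec_index[OF z that] by (rule sum_abs)
    also have "\<dots> = b i" unfolding b_def using nonneg that by (intro sum.cong) (auto simp: abs_mult)
    finally show ?thesis .
  qed
  have row: "y i powr p * (b i / y i) powr q
      \<le> (\<Sum>j<n. A $$ (i, j) * y i powr (p - 1) * (\<bar>z $ j\<bar> powr q / x $ j powr (q - 1)))"
    if i: "i < m" for i
  proof (cases "y i = 0")
    case True
    then show ?thesis by simp
  next
    case False
    then have yi: "0 < y i" using y0[OF i] by linarith
    \<comment> \<open>Jensen with exponent \<open>q\<close>: the weights
      \<open>A $$ (i, j) * x $ j\<close> add up to \<open>y i\<close>, and the points are the ratios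
      of \<open>z\<close> to \<open>x\<close> in absolute value.\<close>
    have "b i powr q = (\<Sum>j<n. (A $$ (i, j) * x $ j) * (\<bar>z $ j\<bar> / x $ j)) powr q"
      unfolding b_def using xpos
      by (intro arg_cong[where f = "\<lambda>s. s powr q"] sum.cong refl) (force simp: field_simps)
    also have "\<dots> \<le> (\<Sum>j<n. A $$ (i, j) * x $ j) powr (q - 1)
        * (\<Sum>j<n. (A $$ (i, j) * x $ j) * (\<bar>z $ j\<bar> / x $ j) powr q)"
      using nonneg[OF i] xpos q1 by (intro powr_weighted_sum_le) (auto simp: less_imp_le)
    also have "(\<Sum>j<n. A $$ (i, j) * x $ j) = y i"
      by (simp only: y_def mult_mat_vec_index[OF positive_carrier[OF x] i])
    also have "(\<Sum>j<n. (A $$ (i, j) * x $ j) * (\<bar>z $ j\<bar> / x $ j) powr q)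
        = (\<Sum>j<n. A $$ (i, j) * (\<bar>z $ j\<bar> powr q / x $ j powr (q - 1)))"
    proof (intro sum.cong refl)
      fix j assume "j \<in> {..<n}"
      then have "0 < x $ j" using xpos by simp
      then show "(A $$ (i, j) * x $ j) * (\<bar>z $ j\<bar> / x $ j) powr q
          = A $$ (i, j) * (\<bar>z $ j\<bar> powr q / x $ j powr (q - 1))"
        by (simp add: powr_divide powr_diff)
    qed
    finally have "y i powr p / y i powr q * b i powr q \<le> y i powr p / y i powr q *
        (y i powr (q - 1) * (\<Sum>j<n. A $$ (i, j) * (\<bar>z $ j\<bar> powr q / x $ j powr (q - 1))))"
      by (intro mult_left_mono) auto
    also have "\<dots> = y i powr (p - 1) * (\<Sum>j<n. A $$ (i, j) * (\<bar>z $ j\<bar> powr q / x $ j powr (q - 1)))"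
      using yi by (simp add: powr_diff)
    finally show ?thesis by (simp add: powr_divide sum_distrib_left mult_ac)
  qed
  have "pnorm p (A *\<^sub>v z) powr q = (\<Sum>i<m. \<bar>(A *\<^sub>v z) $ i\<bar> powr p) powr (q / p)"
    by (rule pnorm_powr[OF mult_mat_vec_carrier])
  also have "\<dots> \<le> (\<Sum>i<m. b i powr p) powr (q / p)"
    using Az p1 pq by (intro powr_mono2 sum_mono sum_nonneg divide_nonneg_nonneg) auto
  \<comment> \<open>Rows with \<open>y i = 0\<close> have \<open>b i = 0\<close> as well, so the
    factorisation survives division by zero.\<close>
  also have "(\<Sum>i<m. b i powr p) = (\<Sum>i<m. y i powr p * (b i / y i) powr p)"
    using by0 by (intro sum.cong refl) (force simp: powr_divide)
  also have "(\<Sum>i<m. y i powr p * (b i / y i) powr p) powr (q / p)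
      \<le> (\<Sum>i<m. y i powr p) powr (q / p - 1) * (\<Sum>i<m. y i powr p * ((b i / y i) powr p) powr (q / p))"
    using p1 pq by (intro powr_weighted_sum_le) auto
  \<comment> \<open>The exponents combine to \<open>p * (q / p) = q\<close>, and
    \<open>q / p - 1 = (q - p) / p\<close> turns the total weight into a power of the norm.\<close>
  also have "\<dots> = pnorm p (A *\<^sub>v x) powr (q - p) * (\<Sum>i<m. y i powr p * (b i / y i) powr q)"
    using p1 by (simp add: pnorm_mult_positive_powr[OF x] y_def powr_powr diff_divide_distrib)
  also have "\<dots> \<le> pnorm p (A *\<^sub>v x) powr (q - p) *
     (\<Sum>i<m. \<Sum>j<n. A $$ (i, j) * y i powr (p - 1) * (\<bar>z $ j\<bar> powr q / x $ j powr (q - 1)))"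
    using row by (intro mult_left_mono sum_mono) auto
  also have "\<dots> = (\<Sum>j<n. \<bar>z $ j\<bar> powr q * potential q p A x $ j)"
    by (subst sum.swap) (simp add: potential_index y_def sum_distrib_left sum_divide_distrib mult_ac)
  finally show ?thesis .
qed

text \<open>The maximum \<open>M\<close> of the finitely many potentials is still strictly below
  \<open>V powr q\<close>, and every quotient is at most \<open>M powr (1 / q)\<close>. This uniform
  bound is what keeps the inequality strict after taking the supremum.\<close>

lemma op_norm_less:
  assumes n: "0 < n" and x: "positive x"
    and less: "\<And>i. i < n \<Longrightarrow> potential q p A x $ i < V powr q" and V: "0 \<le> V"
  shows "op_norm q p A < V"
proof -
  have q1: "1 \<le> q" using p1 pq by linarith
  define M where "M = Max ((\<lambda>i. potential q p A x $ i) ` {..<n})"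
  have M: "potential q p A x $ i \<le> M" if "i < n" for i unfolding M_def using that by simp
  have "M \<in> (\<lambda>i. potential q p A x $ i) ` {..<n}" unfolding M_def using n by (intro Max_in) auto
  then have MV: "M < V powr q" using less by auto
  have M0: "0 \<le> M" using M[OF n] potential_nonneg[OF x n] by linarith
  have bound: "pnorm p (A *\<^sub>v z) / pnorm q z \<le> M powr (1 / q)"
    if z: "z \<in> carrier_vec n" "z \<noteq> 0\<^sub>v n" for z
  proof -
    obtain j where j: "j < n" "z $ j \<noteq> 0" using z by (metis carrier_vecD eq_vecI index_zero_vec)
    have S0: "0 < (\<Sum>j<n. \<bar>z $ j\<bar> powr q)"
      using j by (intro sum_pos2[of _ j]) auto
    then have N0: "0 < pnorm q z" using z by (simp add: pnorm_def)
    have "pnorm p (A *\<^sub>v z) powr q \<le> (\<Sum>j<n. \<bar>z $ j\<bar> powr q * potential q p A x $ j)"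
      by (rule pnorm_mult_le_potential[OF x z(1)])
    also have "\<dots> \<le> (\<Sum>j<n. \<bar>z $ j\<bar> powr q * M)"
      using M by (intro sum_mono mult_left_mono) auto
    also have "\<dots> = M * pnorm q z powr q"
      using q1 S0 by (simp add: sum_distrib_right[symmetric] pnorm_powr[OF z(1)])
    finally have "(pnorm p (A *\<^sub>v z) powr q) powr (1 / q) \<le> (M * pnorm q z powr q) powr (1 / q)"
      using q1 by (intro powr_mono2) auto
    then have "pnorm p (A *\<^sub>v z) \<le> M powr (1 / q) * pnorm q z"
      using q1 by (simp add: powr_powr powr_mult pnorm_nonneg)
    then show ?thesis using N0 by (simp add: field_simps)
  qed
  have "unit_vec n 0 \<in> carrier_vec n" "unit_vec n 0 \<noteq> (0\<^sub>v n :: real vec)"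
    using n by (auto simp: vec_eq_iff unit_vec_def)
  then have "op_norm q p A \<le> M powr (1 / q)"
    unfolding op_norm_def dims using bound by (intro cSup_least) blast+
  also have "\<dots> < (V powr q) powr (1 / q)"
    using M0 MV q1 by (intro powr_less_mono2) auto
  also have "\<dots> = V" using V q1 by (simp add: powr_powr)
  finally show ?thesis .
qed

end

section \<open>One step of the iteration\<close>

locale norm_problem = nonneg_matrix +
  fixes \<epsilon> V :: real
  assumes n_pos: "0 < n" and eps_pos: "0 < \<epsilon>" and eps_le: "\<epsilon> \<le> 1 / (2 * q)" and V_nonneg: "0 \<le> V"
begin

definition active :: "real vec \<Rightarrow> nat set" where
  "active x = {k. k < n \<and> ((1 - \<epsilon> / 4) * V) powr q \<le> potential q p A x $ k}"

definition step :: "real vec \<Rightarrow> real vec" where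
  "step x = x + delta A V \<epsilon> q p x"

text \<open>For positive \<open>x\<close> this is the q-th power of the q-norm; it is the quantity
  that the implementation maintains as \<open>D\<close>.\<close>

definition mass :: "real vec \<Rightarrow> real" where
  "mass x = (\<Sum>k<n. x $ k powr q)"

lemma q_ge_1: "1 \<le> q"
  using p1 pq by linarith

lemma q_eps: "0 < q * \<epsilon>" "q * \<epsilon> \<le> 1 / 2"
  using q_ge_1 eps_pos eps_le by (auto simp: field_simps)

lemma eps_le_half: "\<epsilon> \<le> 1 / 2"
proof -
  have "\<epsilon> \<le> q * \<epsilon>" using q_ge_1 eps_pos by simp
  with q_eps show ?thesis by linarith
qed

lemma active_less: "k \<in> active x \<Longrightarrow> k < n"
  by (simp add: active_def)

lemma step_index:
  assumes "x \<in> carrier_vec n" "k < n"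
  shows "step x $ k = (if k \<in> active x then (1 + \<epsilon> / 8) * x $ k else x $ k)"
  using assms by (auto simp: step_def delta_def active_def algebra_simps)

lemma positive_step: "positive x \<Longrightarrow> positive (step x)"
  using eps_pos step_index[of x] by (auto simp: positive_def) (auto simp: step_def delta_def)

section \<open>Effect of a step on \<open>A x\<close> and on the potential\<close>

lemma mult_step:
  assumes x: "positive x" and i: "i < m"
  shows "(A *\<^sub>v step x) $ i = (A *\<^sub>v x) $ i + (\<Sum>k\<in>active x. A $$ (i, k) * (\<epsilon> / 8 * x $ k))"
proof -
  have "(A *\<^sub>v step x) $ i
      = (\<Sum>k<n. A $$ (i, k) * x $ k + (if k \<in> active x then A $$ (i, k) * (\<epsilon> / 8 * x $ k) else 0))"
    unfolding mult_mat_vec_index[OF positive_carrier[OF positive_step[OF x]] i]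
    using step_index[OF positive_carrier[OF x]] by (intro sum.cong refl) (auto simp: algebra_simps)
  also have "\<dots> = (A *\<^sub>v x) $ i + (\<Sum>k\<in>{..<n} \<inter> active x. A $$ (i, k) * (\<epsilon> / 8 * x $ k))"
    unfolding mult_mat_vec_index[OF positive_carrier[OF x] i] sum.distrib
    by (simp only: sum.inter_restrict finite_lessThan)
  also have "{..<n} \<inter> active x = active x" using active_less by auto
  finally show ?thesis .
qed

lemma mult_step_le:
  assumes x: "positive x" and i: "i < m"
  shows "(A *\<^sub>v step x) $ i \<le> (1 + \<epsilon> / 8) * (A *\<^sub>v x) $ i"
  unfolding mult_mat_vec_index[OF positive_carrier[OF positive_step[OF x]] i]
    mult_mat_vec_index[OF positive_carrier[OF x] i] sum_distrib_left
proof (rule sum_mono)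
  fix k assume k: "k \<in> {..<n}"
  have "step x $ k \<le> (1 + \<epsilon> / 8) * x $ k"
    using k positive_gt_0[OF x] eps_pos by (simp add: step_index[OF positive_carrier[OF x]])
  then have "A $$ (i, k) * step x $ k \<le> A $$ (i, k) * ((1 + \<epsilon> / 8) * x $ k)"
    using nonneg[OF i] k by (intro mult_left_mono) auto
  then show "A $$ (i, k) * step x $ k \<le> (1 + \<epsilon> / 8) * (A $$ (i, k) * x $ k)"
    by (simp add: mult_ac)
qed

lemma pnorm_step_le:
  assumes x: "positive x"
  shows "pnorm p (A *\<^sub>v step x) \<le> (1 + \<epsilon> / 8) * pnorm p (A *\<^sub>v x)"
proof -
  have "pnorm p (A *\<^sub>v step x) powr p \<le> ((1 + \<epsilon> / 8) * pnorm p (A *\<^sub>v x)) powr p"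
  proof -
    have "(\<Sum>i<m. (A *\<^sub>v step x) $ i powr p) \<le> (\<Sum>i<m. ((1 + \<epsilon> / 8) * (A *\<^sub>v x) $ i) powr p)"
      using mult_step_le[OF x] mult_positive_nonneg[OF positive_step[OF x]] p1
      by (intro sum_mono powr_mono2) auto
    also have "\<dots> = (1 + \<epsilon> / 8) powr p * (\<Sum>i<m. (A *\<^sub>v x) $ i powr p)"
      by (simp add: powr_mult sum_distrib_left)
    finally show ?thesis
      using p1 by (simp add: pnorm_mult_positive_powr x positive_step powr_mult sum_nonneg)
  qed
  then have "(pnorm p (A *\<^sub>v step x) powr p) powr (1 / p)
      \<le> (((1 + \<epsilon> / 8) * pnorm p (A *\<^sub>v x)) powr p) powr (1 / p)"
    by - (rule powr_mono2, use p1 in auto)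
  then show ?thesis
    using p1 eps_pos by (simp add: powr_powr pnorm_nonneg)
qed

text \<open>The numerator of the potential is homogeneous in \<open>A x\<close> of degree
  \<open>(q - p) + (p - 1) = q - 1\<close>, and \<open>A x\<close> grows at most by the factor
  \<open>1 + \<epsilon> / 8\<close>. The denominator changes exactly with \<open>x $ k\<close>, so
  for a scaled coordinate the two factors cancel.\<close>

lemma potential_step_le:
  assumes x: "positive x" and k: "k < n"
  shows "potential q p A (step x) $ k
    \<le> ((1 + \<epsilon> / 8) * (x $ k / step x $ k)) powr (q - 1) * potential q p A x $ k"
proof -
  let ?c = "1 + \<epsilon> / 8"
  have c: "0 < ?c" using eps_pos by simp
  have "pnorm p (A *\<^sub>v step x) powr (q - p) \<le> (?c * pnorm p (A *\<^sub>v x)) powr (q - p)"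
    using pnorm_step_le[OF x] pq pnorm_nonneg by (intro powr_mono2) auto
  moreover have "(\<Sum>i<m. A $$ (i, k) * (A *\<^sub>v step x) $ i powr (p - 1))
      \<le> (\<Sum>i<m. A $$ (i, k) * (?c * (A *\<^sub>v x) $ i) powr (p - 1))"
    using mult_step_le[OF x] mult_positive_nonneg[OF positive_step[OF x]] p1 nonneg k
    by (intro sum_mono mult_left_mono powr_mono2) auto
  ultimately have "potential q p A (step x) $ k \<le> (?c * pnorm p (A *\<^sub>v x)) powr (q - p) *
      ((\<Sum>i<m. A $$ (i, k) * (?c * (A *\<^sub>v x) $ i) powr (p - 1)) / (step x $ k) powr (q - 1))"
    unfolding potential_index[OF k] using nonneg k
    by (intro mult_mono divide_right_mono divide_nonneg_nonneg sum_nonneg) auto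
  also have "\<dots> = (?c powr (q - p) * ?c powr (p - 1)) * pnorm p (A *\<^sub>v x) powr (q - p) *
      ((\<Sum>i<m. A $$ (i, k) * (A *\<^sub>v x) $ i powr (p - 1)) / (step x $ k) powr (q - 1))"
    by (simp add: powr_mult sum_distrib_left mult_ac)
  also have "?c powr (q - p) * ?c powr (p - 1) = ?c powr (q - 1)"
    by (simp add: powr_add[symmetric])
  finally show ?thesis
    using positive_gt_0[OF x k] positive_gt_0[OF positive_step[OF x] k]
    by (simp add: potential_index[OF k] powr_mult powr_divide mult_ac)
qed

text \<open>A coordinate whose potential is large after a step has been scaled up in that step: scaled
  coordinates have non-increasing potential, and the potential of the others stays below
  \<open>V\<^sup>q\<close>.\<close>

lemma potential_step_ge:
  assumes x: "positive x" and k: "k < n" and V: "0 < V" and ge: "V powr q \<le> potential q p A (step x) $ k"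
  shows "k \<in> active x" "V powr q \<le> potential q p A x $ k"
proof -
  let ?c = "1 + \<epsilon> / 8"
  have c: "1 \<le> ?c" using eps_pos by simp
  note xk = positive_gt_0[OF x k]
  show act: "k \<in> active x"
  proof (rule ccontr)
    assume na: "k \<notin> active x"
    have "potential q p A (step x) $ k \<le> ?c powr (q - 1) * potential q p A x $ k"
      using potential_step_le[OF x k] xk na k by (simp add: step_index[OF positive_carrier[OF x]])
    \<comment> \<open>Raising the exponent to \<open>q\<close> lets the factor merge with the
      activity threshold, itself a q-th power.\<close>
    also have "\<dots> \<le> ?c powr q * potential q p A x $ k"
      using c by (intro mult_right_mono powr_mono potential_nonneg[OF x k]) auto
    also have "\<dots> < ?c powr q * ((1 - \<epsilon> / 4) * V) powr q"
      using na k c by (simp add: active_def)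
    also have "\<dots> = (?c * (1 - \<epsilon> / 4) * V) powr q" by (simp add: powr_mult mult.assoc)
    also have "\<dots> \<le> V powr q"
    proof -
      \<comment> \<open>The product is \<open>1 - \<epsilon> / 8 - \<epsilon>^2 / 32\<close>: the
        slack in the threshold exceeds the growth of one step.\<close>
      have "?c * (1 - \<epsilon> / 4) \<le> 1" using eps_pos by (simp add: algebra_simps)
      then have "?c * (1 - \<epsilon> / 4) * V \<le> 1 * V" using V by (intro mult_right_mono) auto
      then show ?thesis using eps_pos eps_le_half q_ge_1 V by (intro powr_mono2) auto
    qed
    finally show False using ge by simp
  qed
  have "potential q p A (step x) $ k \<le> potential q p A x $ k"
    using potential_step_le[OF x k] xk act k c by (simp add: step_index[OF positive_carrier[OF x]])
  with ge show "V powr q \<le> potential q p A x $ k" by simp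
qed

section \<open>Growth of the q-norm of \<open>x\<close> and of the p-norm of
  \<open>A x\<close>\<close>

lemma mass_step:
  assumes x: "positive x"
  shows "mass (step x) = mass x + ((1 + \<epsilon> / 8) powr q - 1) * (\<Sum>k\<in>active x. x $ k powr q)"
proof -
  have "mass (step x) = (\<Sum>k<n. x $ k powr q +
      (if k \<in> active x then ((1 + \<epsilon> / 8) powr q - 1) * x $ k powr q else 0))"
    unfolding mass_def using step_index[OF positive_carrier[OF x]]
    by (intro sum.cong refl) (auto simp: powr_mult left_diff_distrib)
  also have "\<dots> = mass x + (\<Sum>k\<in>{..<n} \<inter> active x. ((1 + \<epsilon> / 8) powr q - 1) * x $ k powr q)"
    unfolding mass_def sum.distrib by (simp only: sum.inter_restrict finite_lessThan)
  also have "{..<n} \<inter> active x = active x" using active_less by auto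
  finally show ?thesis by (simp add: sum_distrib_left)
qed

text \<open>The partial derivative of the q-th power of the p-norm of \<open>A x\<close> in
  \<open>x $ k\<close> is \<open>q * x $ k powr (q - 1)\<close> times the potential. The left side
  is therefore the first-order expansion along the step, and the claim is convexity, applied in two
  layers: \<open>p\<close>-th powers in each row and exponent \<open>q / p\<close> on their
  sum.\<close>

lemma pnorm_step_powr_ge:
  assumes x: "positive x"
  shows "pnorm p (A *\<^sub>v x) powr q + q * (\<epsilon> / 8) * (\<Sum>k\<in>active x. x $ k powr q * potential q p A x $ k)
    \<le> pnorm p (A *\<^sub>v step x) powr q"
proof -
  define y where "y i = (A *\<^sub>v x) $ i" for i
  define y' where "y' i = (A *\<^sub>v step x) $ i" for i
  have y: "0 \<le> y i" "0 \<le> y' i" if "i < m" for i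
    using mult_positive_nonneg[OF x that] mult_positive_nonneg[OF positive_step[OF x] that]
    by (auto simp: y_def y'_def)
  define S where "S = (\<Sum>i<m. y i powr p)"
  define S' where "S' = (\<Sum>i<m. y' i powr p)"
  have S: "0 \<le> S" "0 \<le> S'" by (auto simp: S_def S'_def intro: sum_nonneg)
  have qp: "1 \<le> q / p" using p1 pq by simp
  have N: "pnorm p (A *\<^sub>v x) powr (q - p) = S powr (q / p - 1)"
    using p1 by (simp add: pnorm_mult_positive_powr[OF x] S_def y_def diff_divide_distrib)
  have "p * (\<Sum>i<m. y i powr (p - 1) * (\<Sum>k\<in>active x. A $$ (i, k) * (\<epsilon> / 8 * x $ k)))
      = (\<Sum>i<m. p * y i powr (p - 1) * (y' i - y i))"
    unfolding sum_distrib_left[of p] using mult_step[OF x]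
    by (intro sum.cong refl) (auto simp: y_def y'_def)
  also have "\<dots> \<le> (\<Sum>i<m. y' i powr p - y i powr p)"
  proof (rule sum_mono)
    fix i assume "i \<in> {..<m}"
    then show "p * y i powr (p - 1) * (y' i - y i) \<le> y' i powr p - y i powr p"
      using powr_tangent[of "y i" "y' i" p] y p1 by auto
  qed
  also have "\<dots> = S' - S" by (simp add: S_def S'_def sum_subtractf)
  finally have inner: "p * (\<Sum>i<m. y i powr (p - 1) * (\<Sum>k\<in>active x. A $$ (i, k) * (\<epsilon> / 8 * x $ k)))
      \<le> S' - S" .
  have xq: "x $ k powr q / x $ k powr (q - 1) = x $ k" if "k \<in> active x" for k
    using positive_gt_0[OF x active_less[OF that]] by (simp add: powr_diff)
  have "(\<Sum>k\<in>active x. x $ k powr q * potential q p A x $ k)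
      = (\<Sum>k\<in>active x. S powr (q / p - 1) * (\<Sum>i<m. A $$ (i, k) * y i powr (p - 1)) * x $ k)"
  proof (rule sum.cong[OF refl])
    fix k assume k: "k \<in> active x"
    have "x $ k powr q * potential q p A x $ k = S powr (q / p - 1) *
        (\<Sum>i<m. A $$ (i, k) * y i powr (p - 1)) * (x $ k powr q / x $ k powr (q - 1))"
      by (simp add: potential_index[OF active_less[OF k]] N y_def mult_ac)
    then show "x $ k powr q * potential q p A x $ k
        = S powr (q / p - 1) * (\<Sum>i<m. A $$ (i, k) * y i powr (p - 1)) * x $ k"
      by (simp only: xq[OF k])
  qed
  also have "\<dots> = (\<Sum>k\<in>active x. \<Sum>i<m. S powr (q / p - 1) * (A $$ (i, k) * y i powr (p - 1)) * x $ k)"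
    by (simp only: sum_distrib_left sum_distrib_right)
  also have "\<dots> = (\<Sum>i<m. \<Sum>k\<in>active x. S powr (q / p - 1) * (A $$ (i, k) * y i powr (p - 1)) * x $ k)"
    by (rule sum.swap)
  finally have "\<epsilon> / 8 * (\<Sum>k\<in>active x. x $ k powr q * potential q p A x $ k)
      = \<epsilon> / 8 * (\<Sum>i<m. \<Sum>k\<in>active x. S powr (q / p - 1) * (A $$ (i, k) * y i powr (p - 1)) * x $ k)"
    by (simp only:)
  also have "\<dots> = S powr (q / p - 1) *
      (\<Sum>i<m. y i powr (p - 1) * (\<Sum>k\<in>active x. A $$ (i, k) * (\<epsilon> / 8 * x $ k)))"
    by (simp only: sum_distrib_left mult_ac)
  finally have outer: "\<epsilon> / 8 * (\<Sum>k\<in>active x. x $ k powr q * potential q p A x $ k)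
      = S powr (q / p - 1) *
        (\<Sum>i<m. y i powr (p - 1) * (\<Sum>k\<in>active x. A $$ (i, k) * (\<epsilon> / 8 * x $ k)))" .
  \<comment> \<open>Chain rule: \<open>q\<close> splits into the outer slope factor
    \<open>q / p\<close> and the inner factor \<open>p\<close>.\<close>
  have "q * (\<epsilon> / 8) * (\<Sum>k\<in>active x. x $ k powr q * potential q p A x $ k)
      = (q / p * S powr (q / p - 1)) *
        (p * (\<Sum>i<m. y i powr (p - 1) * (\<Sum>k\<in>active x. A $$ (i, k) * (\<epsilon> / 8 * x $ k))))"
    unfolding mult.assoc[of q] outer using p1 by simp
  also have "\<dots> \<le> (q / p * S powr (q / p - 1)) * (S' - S)"
    using inner p1 q_ge_1 by (intro mult_left_mono) auto
  also have "\<dots> \<le> S' powr (q / p) - S powr (q / p)"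
    using powr_tangent[OF S qp] by simp
  finally show ?thesis
    by (simp add: pnorm_mult_positive_powr x positive_step S_def S'_def y_def y'_def)
qed

text \<open>The rate at which \<open>\<parallel>A x\<parallel>\<^sub>p\<^sup>q\<close> grows relative to \<open>\<parallel>x\<parallel>\<^sub>q\<^sup>q\<close>.\<close>

definition rate :: real where
  "rate = q * (\<epsilon> / 8) / ((1 + \<epsilon> / 8) powr q - 1) * ((1 - \<epsilon> / 4) * V) powr q"

lemma scale_powr_gt_1: "1 < (1 + \<epsilon> / 8) powr q"
  using eps_pos q_ge_1 by (intro gr_one_powr) auto

text \<open>The denominator of \<open>rate\<close> cancels the factor by which active coordinates
  increase \<open>mass\<close>; what remains is the first-order gain with each active potential
  replaced by its lower bound.\<close>

lemma growth_step:
  assumes x: "positive x"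
  shows "pnorm p (A *\<^sub>v x) powr q + rate * (mass (step x) - mass x) \<le> pnorm p (A *\<^sub>v step x) powr q"
proof -
  define g where "g = (1 + \<epsilon> / 8) powr q - 1"
  have g: "g \<noteq> 0" using scale_powr_gt_1 by (simp add: g_def)
  have "rate * (mass (step x) - mass x)
      = q * (\<epsilon> / 8) * (\<Sum>k\<in>active x. x $ k powr q * ((1 - \<epsilon> / 4) * V) powr q)"
    unfolding mass_step[OF x] rate_def sum_distrib_right[symmetric] g_def[symmetric]
    using g by simp
  also have "\<dots> \<le> q * (\<epsilon> / 8) * (\<Sum>k\<in>active x. x $ k powr q * potential q p A x $ k)"
    using eps_pos q_ge_1 by (intro mult_left_mono sum_mono) (auto simp: active_def)
  finally show ?thesis using pnorm_step_powr_ge[OF x] by linarith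
qed

section \<open>Bounds on the mass and on the number of rounds\<close>

lemma pnorm_eq_mass: "positive x \<Longrightarrow> pnorm q x = mass x powr (1 / q)"
  by (auto simp: pnorm_def mass_def positive_def intro!: arg_cong[where f = "\<lambda>s. s powr (1 / q)"] sum.cong)

lemma mass_pos: "positive x \<Longrightarrow> 0 < mass x"
  using n_pos unfolding mass_def by (intro sum_pos) (auto dest: positive_gt_0)

text \<open>The invariant bounds the q-th power of the norm of \<open>A x\<close> from below, the
  loop test from above. Dividing both by \<open>((1 - \<epsilon> / 4) * V) powr q\<close> leaves
  \<open>\<theta> * (mass x - 1) < \<rho> * mass x\<close>. Since \<theta> exceeds \<rho> by at
  least \<open>11 / 32 * (q * \<epsilon>)\<close> and is at most 1, the mass is below
  \<open>32 / 11 < 3\<close> divided by \<open>q * \<epsilon>\<close>.\<close>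

lemma mass_bound:
  assumes x: "positive x" and V: "0 < V"
    and inv: "rate * (mass x - 1) \<le> pnorm p (A *\<^sub>v x) powr q"
    and cond: "pnorm p (A *\<^sub>v x) / pnorm q x < (1 - \<epsilon>) * V"
  shows "mass x < 3 / (q * \<epsilon>)"
proof -
  define s where "s = q * \<epsilon>"
  have s: "0 < s" "s \<le> 1 / 2" using q_eps by (auto simp: s_def)
  \<comment> \<open>\<theta> measures the loss from linearising a step; \<rho> compares the loop
    target with the activity threshold.\<close>
  define \<theta> where "\<theta> = (s / 8) / ((1 + \<epsilon> / 8) powr q - 1)"
  define \<rho> where "\<rho> = ((1 - \<epsilon>) / (1 - \<epsilon> / 4)) powr q"
  note M = mass_pos[OF x]
  have "pnorm p (A *\<^sub>v x) < (1 - \<epsilon>) * V * pnorm q x"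
    using cond M by (simp add: pnorm_eq_mass[OF x] field_simps)
  then have "pnorm p (A *\<^sub>v x) powr q < ((1 - \<epsilon>) * V * pnorm q x) powr q"
    using q_ge_1 pnorm_nonneg by (intro powr_less_mono2) auto
  also have "\<dots> = (1 - \<epsilon>) powr q * V powr q * mass x"
    using q_ge_1 M by (simp add: powr_mult pnorm_eq_mass[OF x] powr_powr)
  also have "(1 - \<epsilon>) powr q = \<rho> * (1 - \<epsilon> / 4) powr q"
    using eps_le_half by (simp add: \<rho>_def powr_divide)
  finally have "rate * (mass x - 1) < \<rho> * (1 - \<epsilon> / 4) powr q * V powr q * mass x"
    using inv by linarith
  moreover have "rate = \<theta> * ((1 - \<epsilon> / 4) powr q * V powr q)"
    by (simp add: rate_def \<theta>_def s_def powr_mult)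
  ultimately have "((1 - \<epsilon> / 4) powr q * V powr q) * (\<theta> * (mass x - 1))
      < ((1 - \<epsilon> / 4) powr q * V powr q) * (\<rho> * mass x)"
    by (simp add: mult_ac)
  moreover have "0 < (1 - \<epsilon> / 4) powr q * V powr q" using eps_le_half V by simp
  ultimately have lt: "\<theta> * (mass x - 1) < \<rho> * mass x"
    by (simp only: mult_less_cancel_left_pos)
  have e1: "(1 + \<epsilon> / 8) powr q \<le> exp (s / 8)"
  proof -
    have "(1 + \<epsilon> / 8) powr q \<le> exp (\<epsilon> / 8) powr q"
      using eps_pos q_ge_1 exp_ge_add_one_self[of "\<epsilon> / 8"] by (intro powr_mono2) auto
    then show ?thesis by (simp add: powr_def s_def)
  qed
  \<comment> \<open>Together with \<open>e1\<close> this bounds the denominator of \<theta>, so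
    \<theta> falls short of 1 by at most \<open>s / 8\<close>.\<close>
  have "exp (s / 8) \<le> 1 + s / 8 + (s / 8)\<^sup>2" using s by (intro exp_bound) auto
  with e1 have e2: "(1 + \<epsilon> / 8) powr q - 1 \<le> s / 8 * (1 + s / 8)"
    by (simp add: algebra_simps power2_eq_square)
  have "1 + q * (\<epsilon> / 8) \<le> (1 + \<epsilon> / 8) powr q"
    using powr_tangent[of 1 "1 + \<epsilon> / 8" q] eps_pos q_ge_1 by simp
  then have e3: "s / 8 \<le> (1 + \<epsilon> / 8) powr q - 1" by (simp add: s_def)
  have th1: "\<theta> \<le> 1" using e3 s by (simp add: \<theta>_def)
  have "1 - s / 8 \<le> 1 / (1 + s / 8)" using s by (simp add: field_simps)
  also have "\<dots> = (s / 8) / (s / 8 * (1 + s / 8))" using s by simp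
  also have "\<dots> \<le> \<theta>" unfolding \<theta>_def using e2 e3 s by (intro divide_left_mono) auto
  finally have th2: "1 - s / 8 \<le> \<theta>" .
  have "(1 - \<epsilon>) / (1 - \<epsilon> / 4) \<le> exp (- (3 * \<epsilon> / 4))"
  proof -
    have "(1 - \<epsilon>) / (1 - \<epsilon> / 4) \<le> 1 + - (3 * \<epsilon> / 4)"
      using eps_pos eps_le_half by (simp add: field_simps)
    also have "\<dots> \<le> exp (- (3 * \<epsilon> / 4))" by (rule exp_ge_add_one_self)
    finally show ?thesis .
  qed
  then have "\<rho> \<le> exp (- (3 * \<epsilon> / 4)) powr q"
    unfolding \<rho>_def using eps_le_half q_ge_1 by (intro powr_mono2) auto
  also have "\<dots> = exp (- (3 * s / 4))" by (simp add: powr_def s_def)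
  also have "\<dots> = 1 / exp (3 * s / 4)" by (simp add: exp_minus field_simps)
  also have "\<dots> \<le> 1 / (1 + 3 * s / 4)"
    using s exp_ge_add_one_self[of "3 * s / 4"] by (intro divide_left_mono) auto
  also have "\<dots> \<le> 1 - 15 * s / 32"
  proof -
    have "s * s \<le> s * (1 / 2)" using s by (intro mult_left_mono) auto
    \<comment> \<open>The product is \<open>1 + 9 * s / 32 - 45 * s * s / 128\<close>; as
      \<open>s \<le> 1 / 2\<close>, the quadratic loss is smaller than the linear gain.\<close>
    then have "1 \<le> (1 - 15 * s / 32) * (1 + 3 * s / 4)"
      using s by (simp add: algebra_simps)
    then show ?thesis using s by (simp add: field_simps)
  qed
  finally have rh: "\<rho> \<le> 1 - 15 * s / 32" .
  \<comment> \<open>\<open>15 / 32 - 1 / 8 = 11 / 32\<close>.\<close>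
  have "11 / 32 * s \<le> \<theta> - \<rho>" using th2 rh by linarith
  then have "11 / 32 * s * mass x \<le> (\<theta> - \<rho>) * mass x" using M by (intro mult_right_mono) auto
  also have "\<dots> < 1" using lt th1 by (simp add: algebra_simps)
  finally have "11 / 32 * (mass x * s) < 1" by (simp only: mult_ac)
  moreover have "0 < mass x * s" using M s by simp
  ultimately have "mass x * s < 3" by linarith
  then show ?thesis unfolding s_def[symmetric] using s by (simp only: pos_less_divide_eq)
qed

text \<open>A coordinate scaled \<open>t\<close> times alone contributes
  \<open>(1 + \<epsilon> / 8) powr (t * q) / n\<close> to the mass. Taking logarithms bounds
  \<open>t * q * (\<epsilon> / 16)\<close> by \<open>3 * ln (n / s)\<close>, whence
  \<open>48 = 3 * 16\<close>.\<close>

lemma iteration_bound: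
  assumes x: "positive x" and i: "i < n" and xi: "x $ i = (1 + \<epsilon> / 8) ^ t * real n powr (- 1 / q)"
    and M: "mass x < 3 / (q * \<epsilon>)"
  shows "real t < 48 * (1 / (q * \<epsilon>) * ln (real n / (q * \<epsilon>)))"
proof -
  define s where "s = q * \<epsilon>"
  have s: "0 < s" "s \<le> 1 / 2" using q_eps by (auto simp: s_def)
  let ?c = "1 + \<epsilon> / 8"
  have c: "0 < ?c" using eps_pos by simp
  have n: "1 \<le> real n" using n_pos by simp
  have "?c powr (real t * q) / real n = x $ i powr q"
  proof -
    have "x $ i powr q = (?c powr real t) powr q * (real n powr (- 1 / q)) powr q"
      using c by (simp add: xi powr_mult powr_realpow)
    also have "\<dots> = ?c powr (real t * q) * real n powr (- 1)"
      using q_ge_1 by (simp add: powr_powr)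
    finally show ?thesis using n by (simp add: powr_minus_divide)
  qed
  also have "\<dots> \<le> mass x" unfolding mass_def using i by (intro member_le_sum) auto
  also have "\<dots> < 3 / s" using M by (simp add: s_def)
  finally have "?c powr (real t * q) < 3 * (real n / s)"
    using n s by (simp add: field_simps)
  then have "ln (?c powr (real t * q)) < ln (3 * (real n / s))"
    using c n s by (subst ln_less_cancel_iff) auto
  then have "real t * q * ln ?c < ln 3 + ln (real n / s)"
    using ln_mult[of 3 "real n / s"] n s by simp
  moreover have "\<epsilon> / 16 \<le> ln ?c"
  proof -
    have "(\<epsilon> / 8) * (\<epsilon> / 8) \<le> (\<epsilon> / 8) * (1 / 2)"
      using eps_pos eps_le_half by (intro mult_left_mono) auto
    then have "\<epsilon> / 16 \<le> \<epsilon> / 8 - (\<epsilon> / 8)\<^sup>2" by (simp add: power2_eq_square)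
    also have "\<dots> \<le> ln ?c" using eps_pos eps_le_half by (intro ln_one_plus_pos_lower_bound) auto
    finally show ?thesis .
  qed
  then have "real t * q * (\<epsilon> / 16) \<le> real t * q * ln ?c"
    using q_ge_1 by (intro mult_left_mono) auto
  \<comment> \<open>The constant is absorbed because \<open>n / s \<ge> 2\<close> and
    \<open>3 \<le> 2 ^ 2\<close>.\<close>
  moreover have "ln 3 \<le> 2 * ln (real n / s)"
  proof -
    have "2 \<le> 1 / s" using s by (simp add: field_simps)
    also have "\<dots> \<le> real n / s" using n s by (intro divide_right_mono) auto
    finally have "ln 2 \<le> ln (real n / s)" by (subst ln_le_cancel_iff) auto
    moreover have "ln 3 \<le> 2 * ln (2 :: real)"
    proof -
      have "ln 3 \<le> ln ((2 :: real) ^ 2)" by (subst ln_le_cancel_iff) auto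
      then show ?thesis using ln_realpow[of 2 2] by linarith
    qed
    ultimately show ?thesis by linarith
  qed
  ultimately have "real t * s < 48 * ln (real n / s)" by (simp add: s_def algebra_simps)
  then have "real t < 48 * ln (real n / s) / s" using s by (simp only: pos_less_divide_eq)
  then show ?thesis by (simp add: s_def)
qed

end

section \<open>Values and costs of the timed programs\<close>

lemma val_bindT [simp]: "val (bindT M f) = val (f (val M))"
  and time_bindT [simp]: "time (bindT M f) = time M + time (f (val M))"
  by (simp_all add: bindT_def)

lemma val_op [simp]:
  "val (returnT s) = s" "val (addT a b) = a + b" "val (subT a b) = a - b" "val (mulT a b) = a * b"
  "val (divT a b) = a / b" "val (lessT a b) = (a < b)" "val (leT a b) = (a \<le> b)"
  "val (andT c d) = (c \<and> d)" "val (notT c) = (\<not> c)" "val (scalar_powT a b) = a powr b"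
  "val (entry_powT a b) = a powr b" "val (newT k a) = vec k (\<lambda>_. a)" "val (readT z i) = z $ i"
  "val (writeT z i a) = vec (dim_vec z) (\<lambda>j. if j = i then a else z $ j)"
  by (simp_all add: returnT_def addT_def subT_def mulT_def divT_def lessT_def leT_def andT_def
      notT_def scalar_powT_def entry_powT_def newT_def readT_def writeT_def)

lemma time_op [simp]:
  "time (returnT s) = 0" "time (addT a b) = 1" "time (subT a b) = 1" "time (mulT a b) = 1"
  "time (divT a b) = 1" "time (lessT a b) = 1" "time (leT a b) = 1"
  "time (andT c d) = 1" "time (notT c) = 1" "time (scalar_powT a b) = 1"
  "time (newT k a) = 1" "time (readT z i) = 1" "time (writeT z i a) = 1"
  by (simp_all add: returnT_def addT_def subT_def mulT_def divT_def lessT_def leT_def andT_def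
      notT_def scalar_powT_def newT_def readT_def writeT_def)

lemma val_forT: "val (forT xs f s) = fold (\<lambda>a s. val (f a s)) xs s"
  by (induction xs arbitrary: s) auto

text \<open>One unit is charged per iteration and one for reaching the end of the list. The bound
  \<open>g\<close> must hold for every loop state.\<close>

lemma time_forT_le:
  assumes "\<And>a s. a \<in> set xs \<Longrightarrow> time (f a s) \<le> g a"
  shows "time (forT xs f s) \<le> 1 + (\<Sum>a\<leftarrow>xs. 1 + g a)"
  using assms
proof (induction xs arbitrary: s)
  case (Cons a xs)
  have "time (f a s) \<le> g a" using Cons.prems by simp
  moreover have "time (forT xs f (val (f a s))) \<le> 1 + (\<Sum>a\<leftarrow>xs. 1 + g a)"
    using Cons.prems by (intro Cons.IH) auto
  ultimately show ?case by simp
qed simp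

text \<open>The written values do not depend on the array being built, so successive writes amount
  to one pointwise update.\<close>

lemma fold_write:
  "fold (\<lambda>i w. vec (dim_vec w) (\<lambda>j. if j = i then g i else w $ j)) is w
    = vec (dim_vec w) (\<lambda>j. if j \<in> set is then g j else w $ j)"
  by (induction "is" arbitrary: w) (auto simp: vec_eq_iff)

lemma val_dotT: "val (dotT es z) = (\<Sum>(j, a)\<leftarrow>es. a * z $ j)"
proof -
  have "fold (\<lambda>(j, a) s. s + a * z $ j) es s = s + (\<Sum>(j, a)\<leftarrow>es. a * z $ j)" for s
    by (induction es arbitrary: s) auto
  then show ?thesis
    by (simp add: dotT_def val_forT case_prod_unfold)
qed

lemma time_dotT: "time (dotT es z) \<le> 1 + 4 * length es"
proof -
  have "time (dotT es z) \<le> 1 + (\<Sum>a\<leftarrow>es. 1 + 3)"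
    unfolding dotT_def by (rule time_forT_le) auto
  then show ?thesis by (simp add: sum_list_triv)
qed

section \<open>Indices and sizes of the sparse representation\<close>

definition nz_rows :: "real mat \<Rightarrow> nat list" where
  "nz_rows A = filter (\<lambda>i. row_entries A i \<noteq> []) [0..<dim_row A]"

lemma sparse_rows_eq: "sparse_rows A = map (\<lambda>i. (i, row_entries A i)) (nz_rows A)"
  by (simp add: sparse_rows_def nz_rows_def)

lemma set_nz_rows: "set (nz_rows A) = {i. i < dim_row A \<and> row_entries A i \<noteq> []}"
  by (auto simp: nz_rows_def)

lemma distinct_nz_rows: "distinct (nz_rows A)"
  by (simp add: nz_rows_def)

lemma val_dotT_row_entries:
  assumes "i < dim_row A" "dim_vec z = dim_col A"
  shows "val (dotT (row_entries A i) z) = (A *\<^sub>v z) $ i"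
proof -
  have "val (dotT (row_entries A i) z)
      = (\<Sum>j\<leftarrow>filter (\<lambda>j. A $$ (i, j) \<noteq> 0) [0..<dim_col A]. A $$ (i, j) * z $ j)"
    by (simp add: val_dotT row_entries_def comp_def)
  also have "\<dots> = (\<Sum>j\<leftarrow>[0..<dim_col A]. A $$ (i, j) * z $ j)"
    by (rule sum_list_map_filter) auto
  also have "\<dots> = (A *\<^sub>v z) $ i"
    using assms by (simp add: interv_sum_list_conv_sum_set_nat scalar_prod_def)
  finally show ?thesis .
qed

text \<open>The entry list of such a row is empty. This is why the default 0 of a new array is right
  for rows that the loops skip.\<close>

lemma mult_mat_vec_not_nz_row:
  assumes "i < dim_row A" "dim_vec z = dim_col A" "i \<notin> set (nz_rows A)"
  shows "(A *\<^sub>v z) $ i = 0"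
  using val_dotT_row_entries[OF assms(1,2)] assms(1,3) by (simp add: set_nz_rows val_dotT)

lemma sum_length_row_entries: "(\<Sum>i\<leftarrow>nz_rows A. length (row_entries A i)) = nnz A"
proof -
  have len: "length (row_entries A i) = card {j. j < dim_col A \<and> A $$ (i, j) \<noteq> 0}" for i
    by (simp add: row_entries_def length_filter_conv_card) 
      (rule arg_cong[where f = card], auto)
  have "(\<Sum>i\<leftarrow>nz_rows A. length (row_entries A i)) = (\<Sum>i\<leftarrow>[0..<dim_row A]. length (row_entries A i))"
    unfolding nz_rows_def by (rule sum_list_map_filter) auto
  also have "\<dots> = (\<Sum>i<dim_row A. card {j. j < dim_col A \<and> A $$ (i, j) \<noteq> 0})"
    by (simp add: interv_sum_list_conv_sum_set_nat lessThan_atLeast0 len)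
  also have "\<dots> = card (SIGMA i:{..<dim_row A}. {j. j < dim_col A \<and> A $$ (i, j) \<noteq> 0})"
    by (rule card_SigmaI[symmetric]) auto
  also have "(SIGMA i:{..<dim_row A}. {j. j < dim_col A \<and> A $$ (i, j) \<noteq> 0})
      = {(i, j). i < dim_row A \<and> j < dim_col A \<and> A $$ (i, j) \<noteq> 0}"
    by auto
  finally show ?thesis by (simp add: nnz_def)
qed

lemma length_nz_rows_le_nnz: "length (nz_rows A) \<le> nnz A"
proof -
  have "length (nz_rows A) = (\<Sum>i\<leftarrow>nz_rows A. 1)" by (simp add: sum_list_triv)
  also have "\<dots> \<le> (\<Sum>i\<leftarrow>nz_rows A. length (row_entries A i))"
    by (rule sum_list_mono) (auto simp: set_nz_rows Suc_le_eq)
  finally show ?thesis by (simp only: sum_length_row_entries)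
qed

lemma length_nz_rows_le_dim: "length (nz_rows A) \<le> dim_row A"
  unfolding nz_rows_def by (metis diff_zero length_filter_le length_upt)

lemma nnz_transpose: "nnz (transpose_mat A) = nnz A"
  unfolding nnz_def
  by (rule bij_betw_same_card[of prod.swap]) (auto simp: bij_betw_def inj_on_def image_iff)

section \<open>Sparse matrix-vector product, norm and potential\<close>

lemma val_mat_vecT:
  assumes "dim_row A = m" "dim_vec x = dim_col A"
  shows "val (mat_vecT m (sparse_rows A) x) = A *\<^sub>v x"
proof -
  have "val (mat_vecT m (sparse_rows A) x) = fold (\<lambda>i w. vec (dim_vec w)
      (\<lambda>j. if j = i then val (dotT (row_entries A i) x) else w $ j)) (nz_rows A) (vec m (\<lambda>_. 0))"
    by (simp add: mat_vecT_def sparse_rows_eq val_forT fold_map comp_def)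
  then show ?thesis
    using assms by (auto simp: fold_write vec_eq_iff val_dotT_row_entries mult_mat_vec_not_nz_row
        simp del: index_mult_mat_vec)
qed

lemma time_mat_vecT: "time (mat_vecT m (sparse_rows A) x) \<le> 2 + 3 * length (nz_rows A) + 4 * nnz A"
proof -
  have "time (mat_vecT m (sparse_rows A) x)
      \<le> 1 + (1 + (\<Sum>a\<leftarrow>sparse_rows A. 1 + (2 + 4 * length (snd a))))"
    unfolding mat_vecT_def time_bindT
    by (rule add_mono[OF _ time_forT_le]) (auto intro: time_dotT[simplified])
  also have "\<dots> = 2 + (\<Sum>i\<leftarrow>nz_rows A. 3 + 4 * length (row_entries A i))"
    by (simp add: sparse_rows_eq comp_def numeral_3_eq_3)
  also have "\<dots> = 2 + 3 * length (nz_rows A) + 4 * nnz A"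
    unfolding sum_list_addf by (simp add: sparse_rows_eq comp_def sum_list_addf sum_list_triv sum_list_const_mult
        sum_length_row_entries[symmetric])
  finally show ?thesis .
qed

lemma val_pnormT:
  assumes "y \<in> carrier_vec (dim_row A)" and nonneg: "\<And>i. i < dim_row A \<Longrightarrow> 0 \<le> y $ i"
    and supp: "\<And>i. i < dim_row A \<Longrightarrow> i \<notin> set (nz_rows A) \<Longrightarrow> y $ i = 0"
  shows "val (pnormT p (sparse_rows A) y) = pnorm p y"
proof -
  have fold_sum: "fold (\<lambda>i s. s + y $ i powr p) is s = s + (\<Sum>i\<leftarrow>is. y $ i powr p)" for s "is"
    by (induction "is" arbitrary: s) auto
  have "(\<Sum>i\<leftarrow>nz_rows A. y $ i powr p) = (\<Sum>i\<in>set (nz_rows A). y $ i powr p)"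
    by (rule sum_list_distinct_conv_sum_set[OF distinct_nz_rows])
  \<comment> \<open>Skipped rows contribute \<open>0 powr p\<close>, which is 0 for every
    \<open>p\<close>.\<close>
  also have "\<dots> = (\<Sum>i<dim_row A. \<bar>y $ i\<bar> powr p)"
    using nonneg supp by (intro sum.mono_neutral_cong_left) (auto simp: set_nz_rows)
  finally show ?thesis
    using assms(1) by (simp add: pnormT_def sparse_rows_eq val_forT
        fold_map comp_def fold_sum pnorm_def)
qed

text \<open>The logarithmic part of the charge of \<open>entry_powT\<close>; its additive unit is
  counted among the constants.\<close>

definition pow_cost :: "real \<Rightarrow> nat" where
  "pow_cost p = nat \<lceil>log 2 (1 + p)\<rceil>"

lemma time_pnormT:
  "time (pnormT p (sparse_rows A) y) \<le> 3 + length (nz_rows A) * (4 + pow_cost p)"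
proof -
  have "time (pnormT p (sparse_rows A) y) \<le> (1 + (\<Sum>a\<leftarrow>sparse_rows A. 1 + (3 + pow_cost p))) + 2"
    unfolding pnormT_def time_bindT
    by (rule add_mono[OF time_forT_le]) (auto simp: entry_powT_def pow_cost_def)
  also have "\<dots> = 3 + length (nz_rows A) * (4 + pow_cost p)"
    by (simp add: sparse_rows_eq comp_def sum_list_triv)
  finally show ?thesis .
qed

text \<open>Skipping is sound on both sides: an unlisted row leaves the default 0, which equals
  \<open>0 powr (p - 1)\<close> even for \<open>p = 1\<close>, and an unlisted column has scalar
  product 0 and hence potential 0.\<close>

lemma val_potentialT:
  assumes A: "A \<in> carrier_mat m n" and x: "x \<in> carrier_vec n"
    and nonneg: "\<And>i. i < m \<Longrightarrow> 0 \<le> (A *\<^sub>v x) $ i"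
  shows "val (potentialT m n (sparse_rows A) (sparse_cols A) q p x (vec n (\<lambda>k. x $ k powr (q - 1))))
    = potential q p A x"
proof -
  have dims: "dim_row A = m" "dim_col A = n" "dim_vec x = n" using A x by auto
  define y where "y = A *\<^sub>v x"
  have y1: "y \<in> carrier_vec m" unfolding y_def using A x by (rule mult_mat_vec_carrier)
  have y2: "y $ i = 0" if "i < m" "i \<notin> set (nz_rows A)" for i
    unfolding y_def by (rule mult_mat_vec_not_nz_row) (use dims that in auto)
  have v1: "val (mat_vecT m (sparse_rows A) x) = y"
    unfolding y_def by (rule val_mat_vecT) (use dims in auto)
  have v2: "val (pnormT p (sparse_rows A) y) = pnorm p y"
    by (rule val_pnormT) (use y1 y2 nonneg dims in \<open>auto simp: y_def[symmetric]\<close>)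
  define w where "w = vec_powr y (p - 1)"
  have w: "dim_vec w = m" using y1 by (simp add: w_def vec_powr_def)
  have v3: "fold (\<lambda>i w. vec (dim_vec w) (\<lambda>j. if j = i then y $ i powr (p - 1) else w $ j)) (nz_rows A)
      (vec m (\<lambda>_. 0)) = w"
    unfolding fold_write by (rule eq_vecI) (use y1 y2 in \<open>auto simp: w_def vec_powr_def\<close>)
  have col: "val (dotT (row_entries (transpose_mat A) k) w) = col A k \<bullet> w" if "k < n" for k
    using val_dotT_row_entries[of k "transpose_mat A" w] w dims that by simp
  have col0: "col A k \<bullet> w = 0" if "k < n" "k \<notin> set (nz_rows (transpose_mat A))" for k
    using mult_mat_vec_not_nz_row[of k "transpose_mat A" w] w dims that by simp
  have "val (potentialT m n (sparse_rows A) (sparse_cols A) q p x (vec n (\<lambda>k. x $ k powr (q - 1))))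
     = fold (\<lambda>k f. vec (dim_vec f) (\<lambda>j. if j = k then pnorm p y powr (q - p) *
          val (dotT (row_entries (transpose_mat A) k) w) / vec n (\<lambda>k. x $ k powr (q - 1)) $ k else f $ j))
        (nz_rows (transpose_mat A)) (vec n (\<lambda>_. 0))"
    by (simp add: potentialT_def v1 v2) (simp add: val_forT sparse_rows_eq sparse_cols_def fold_map comp_def v3)
  also have "\<dots> = potential q p A x"
    unfolding fold_write potential_def y_def[symmetric] w_def[symmetric]
    by (rule eq_vecI) (use dims col col0 in auto)
  finally show ?thesis .
qed

lemma pow_cost_mono: "1 \<le> p \<Longrightarrow> pow_cost (p - 1) \<le> pow_cost p"
  unfolding pow_cost_def by (intro nat_mono ceiling_mono) simp

lemma time_potentialT:
  assumes p: "1 \<le> p"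
  shows "time (potentialT m n (sparse_rows A) (sparse_cols A) q p x u)
    \<le> 12 + 11 * length (nz_rows A) + 2 * (length (nz_rows A) * pow_cost p) + 8 * nnz A
      + 6 * length (nz_rows (transpose_mat A))"
proof -
  let ?R = "length (nz_rows A)" and ?C = "length (nz_rows (transpose_mat A))"
  have f1: "time (forT (sparse_rows A) (\<lambda>(i, _) w. bindT (readT y i) (\<lambda>a. bindT (entry_powT a (p - 1)) (writeT w i))) w)
      \<le> 1 + ?R * (4 + pow_cost p)" for y w
  proof -
    have "time (forT (sparse_rows A) (\<lambda>(i, _) w. bindT (readT y i) (\<lambda>a. bindT (entry_powT a (p - 1)) (writeT w i))) w)
      \<le> 1 + (\<Sum>a\<leftarrow>sparse_rows A. 1 + (3 + pow_cost p))"
      using pow_cost_mono[OF p]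
      by (intro time_forT_le) (auto simp: entry_powT_def pow_cost_def)
    also have "\<dots> = 1 + ?R * (4 + pow_cost p)"
      by (simp add: sparse_rows_eq comp_def sum_list_triv)
    finally show ?thesis .
  qed
  have f2: "time (forT (sparse_cols A) (\<lambda>(k, es) f. bindT (dotT es w) (\<lambda>g. bindT (readT u k)
        (\<lambda>v. bindT (divT g v) (\<lambda>h. bindT (mulT c h) (writeT f k))))) f) \<le> 1 + 6 * ?C + 4 * nnz A" for w c f
  proof -
    have "time (forT (sparse_cols A) (\<lambda>(k, es) f. bindT (dotT es w) (\<lambda>g. bindT (readT u k)
        (\<lambda>v. bindT (divT g v) (\<lambda>h. bindT (mulT c h) (writeT f k))))) f)
      \<le> 1 + (\<Sum>a\<leftarrow>sparse_cols A. 1 + (5 + 4 * length (snd a)))"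
      by (intro time_forT_le) (auto intro: time_dotT[simplified])
    also have "\<dots> = 1 + 6 * ?C + 4 * nnz A"
      by (simp add: sparse_cols_def sparse_rows_eq comp_def sum_list_addf sum_list_triv
          sum_list_const_mult sum_length_row_entries nnz_transpose)
    finally show ?thesis .
  qed
  have "time (potentialT m n (sparse_rows A) (sparse_cols A) q p x u)
      \<le> (2 + 3 * ?R + 4 * nnz A) + ((3 + ?R * (4 + pow_cost p)) + (1 + (1 + (1 + (1 +
        ((1 + ?R * (4 + pow_cost p)) + (1 + (1 + 6 * ?C + 4 * nnz A))))))))"
    unfolding potentialT_def time_bindT val_bindT val_op time_op
    by (intro add_mono time_mat_vecT time_pnormT f1 f2 order_refl)
  then show ?thesis by (simp add: algebra_simps)
qed

section \<open>Update of the loop state and the infeasibility check\<close>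

lemma val_updateT:
  assumes "distinct ks" "x \<in> carrier_vec n" "u \<in> carrier_vec n" "set ks \<subseteq> {..<n}"
  shows "val (updateT (map (\<lambda>k. (k, g k)) ks) \<alpha> \<beta> \<gamma> thr f (x, u, D)) =
    (vec n (\<lambda>k. if k \<in> set ks \<and> thr \<le> f $ k then x $ k + \<alpha> * x $ k else x $ k),
     vec n (\<lambda>k. if k \<in> set ks \<and> thr \<le> f $ k then \<beta> * u $ k else u $ k),
     D + (\<Sum>k | k \<in> set ks \<and> thr \<le> f $ k. \<gamma> * (x $ k * u $ k)))"
  using assms
proof (induction ks arbitrary: x u D)
  case Nil
  then show ?case by (auto simp: updateT_def vec_eq_iff)
next
  case (Cons k ks)
  show ?case
  proof (cases "thr \<le> f $ k")
    case False
    then have "val (updateT (map (\<lambda>k. (k, g k)) (k # ks)) \<alpha> \<beta> \<gamma> thr f (x, u, D))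
        = val (updateT (map (\<lambda>k. (k, g k)) ks) \<alpha> \<beta> \<gamma> thr f (x, u, D))"
      by (simp add: updateT_def)
    moreover have "j \<in> set (k # ks) \<and> thr \<le> f $ j \<longleftrightarrow> j \<in> set ks \<and> thr \<le> f $ j" for j
      using False by auto
    ultimately show ?thesis using Cons by simp
  next
    case True
    define x' where "x' = vec n (\<lambda>j. if j = k then x $ k + \<alpha> * x $ k else x $ j)"
    define u' where "u' = vec n (\<lambda>j. if j = k then \<beta> * u $ k else u $ j)"
    have dims: "dim_vec x = n" "dim_vec u = n" using Cons.prems by auto
    have "val (updateT (map (\<lambda>k. (k, g k)) (k # ks)) \<alpha> \<beta> \<gamma> thr f (x, u, D))
        = val (updateT (map (\<lambda>k. (k, g k)) ks) \<alpha> \<beta> \<gamma> thr f (x', u', D + \<gamma> * (x $ k * u $ k)))"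
      using True by (simp add: updateT_def x'_def u'_def dims)
    also have "\<dots> = (vec n (\<lambda>k. if k \<in> set ks \<and> thr \<le> f $ k then x' $ k + \<alpha> * x' $ k else x' $ k),
     vec n (\<lambda>k. if k \<in> set ks \<and> thr \<le> f $ k then \<beta> * u' $ k else u' $ k),
     D + \<gamma> * (x $ k * u $ k) + (\<Sum>k | k \<in> set ks \<and> thr \<le> f $ k. \<gamma> * (x' $ k * u' $ k)))"
      using Cons.prems by (intro Cons.IH) (auto simp: x'_def u'_def)
    \<comment> \<open>By distinctness \<open>k\<close> does not recur, so the remaining coordinates
      still hold their original values.\<close>
    also have "(\<Sum>k | k \<in> set ks \<and> thr \<le> f $ k. \<gamma> * (x' $ k * u' $ k))
        = (\<Sum>k | k \<in> set ks \<and> thr \<le> f $ k. \<gamma> * (x $ k * u $ k))"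
    proof (intro sum.cong refl)
      fix j assume "j \<in> {k. k \<in> set ks \<and> thr \<le> f $ k}"
      then have "j < n" "j \<noteq> k" using Cons.prems by auto
      then show "\<gamma> * (x' $ j * u' $ j) = \<gamma> * (x $ j * u $ j)" by (simp add: x'_def u'_def)
    qed
    also have "D + \<gamma> * (x $ k * u $ k) + \<dots>
        = D + (\<Sum>j | j \<in> set (k # ks) \<and> thr \<le> f $ j. \<gamma> * (x $ j * u $ j))"
    proof -
      have "{j. j \<in> set (k # ks) \<and> thr \<le> f $ j} = insert k {j. j \<in> set ks \<and> thr \<le> f $ j}"
        using True by auto
      then show ?thesis using Cons.prems by simp
    qed
    finally show ?thesis
      using Cons.prems True by (auto simp: x'_def u'_def vec_eq_iff)
  qed
qed

lemma time_updateT: "time (updateT cs \<alpha> \<beta> \<gamma> thr f s) \<le> 1 + 13 * length cs"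
proof -
  have "time (updateT cs \<alpha> \<beta> \<gamma> thr f s) \<le> 1 + (\<Sum>a\<leftarrow>cs. 1 + 12)"
    unfolding updateT_def by (rule time_forT_le) (auto split: prod.splits)
  then show ?thesis by (simp add: sum_list_triv)
qed

lemma val_infeasibleT:
  "val (infeasibleT (map (\<lambda>k. (k, g k)) ks) W f) \<longleftrightarrow> (\<forall>k\<in>set ks. f $ k < W)"
proof -
  have "fold (\<lambda>k b. b \<and> f $ k < W) ks b \<longleftrightarrow> b \<and> (\<forall>k\<in>set ks. f $ k < W)" for b
    by (induction ks arbitrary: b) auto
  then show ?thesis by (simp add: infeasibleT_def val_forT fold_map comp_def)
qed

lemma time_infeasibleT: "time (infeasibleT cs W f) \<le> 1 + 4 * length cs"
proof -
  have "time (infeasibleT cs W f) \<le> 1 + (\<Sum>a\<leftarrow>cs. 1 + 3)"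
    unfolding infeasibleT_def by (rule time_forT_le) auto
  then show ?thesis by (simp add: sum_list_triv)
qed

section \<open>Cost of one round\<close>

lemma length_sparse_cols: "length (sparse_cols A) = length (nz_rows (transpose_mat A))"
  by (simp add: sparse_cols_def sparse_rows_eq)

lemma time_condT:
  "time (condT m (sparse_rows A) q p target s)
    \<le> 11 + 7 * length (nz_rows A) + 4 * nnz A + length (nz_rows A) * pow_cost p"
proof -
  obtain x u D b where s: "s = (x, u, D, b)" by (cases s)
  show ?thesis
    using time_mat_vecT[of m A x] time_pnormT[of p A "val (mat_vecT m (sparse_rows A) x)"]
    by (simp add: s condT_def algebra_simps)
qed

lemma time_bodyT:
  assumes p: "1 \<le> p"
  shows "time (bodyT m n (sparse_rows A) (sparse_cols A) q p \<alpha> \<beta> \<gamma> thr W s)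
    \<le> 26 + 22 * length (nz_rows A) + 4 * (length (nz_rows A) * pow_cost p) + 16 * nnz A
      + 29 * length (nz_rows (transpose_mat A))"
proof -
  obtain x u D b where s: "s = (x, u, D, b)" by (cases s)
  define f where "f = val (potentialT m n (sparse_rows A) (sparse_cols A) q p x u)"
  obtain x' u' D' where s': "val (updateT (sparse_cols A) \<alpha> \<beta> \<gamma> thr f (x, u, D)) = (x', u', D')"
    by (cases "val (updateT (sparse_cols A) \<alpha> \<beta> \<gamma> thr f (x, u, D))")
  show ?thesis
    using time_potentialT[OF p, of m n A q x u] time_potentialT[OF p, of m n A q x' u']
      time_updateT[of "sparse_cols A" \<alpha> \<beta> \<gamma> thr f "(x, u, D)"]
      time_infeasibleT[of "sparse_cols A" W "val (potentialT m n (sparse_rows A) (sparse_cols A) q p x' u')"]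
    by (simp add: s bodyT_def f_def[symmetric] s' length_sparse_cols returnT_def)
qed

text \<open>An upper bound for one loop test plus one execution of the body; for \<open>A \<noteq> 0\<close> the constant
  and the numbers of nonzero rows and columns are absorbed into \<open>nnz A\<close>.\<close>

definition round_cost :: "real mat \<Rightarrow> real \<Rightarrow> nat" where
  "round_cost A p = (if nnz A = 0 then 37 else 115 * nnz A + 5 * (length (nz_rows A) * pow_cost p))"

lemma time_round:
  assumes p: "1 \<le> p"
  shows "time (condT m (sparse_rows A) q p target s)
    + time (bodyT m n (sparse_rows A) (sparse_cols A) q p \<alpha> \<beta> \<gamma> thr W s') \<le> round_cost A p"
proof -
  have "time (condT m (sparse_rows A) q p target s)
      + time (bodyT m n (sparse_rows A) (sparse_cols A) q p \<alpha> \<beta> \<gamma> thr W s')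
    \<le> 37 + 29 * length (nz_rows A) + 29 * length (nz_rows (transpose_mat A)) + 20 * nnz A
      + 5 * (length (nz_rows A) * pow_cost p)"
    using time_condT[of m A q p target s] time_bodyT[OF p, of m n A q \<alpha> \<beta> \<gamma> thr W s'] by linarith
  \<comment> \<open>With \<open>nnz A \<ge> 1\<close> the coefficients add up to
    \<open>37 + 29 + 29 + 20 = 115\<close>; with \<open>nnz A = 0\<close> both index lists are empty
    and only 37 is left.\<close>
  then show ?thesis
    using length_nz_rows_le_nnz[of A] length_nz_rows_le_nnz[of "transpose_mat A"]
    by (cases "nnz A = 0") (auto simp: round_cost_def nnz_transpose)
qed

text \<open>The number of listed rows is bounded in two ways: by \<open>nnz A\<close> where it
  multiplies a constant, by \<open>dim_row A\<close> where it multiplies \<open>ln p\<close>. The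
  constant is \<open>115 + 5 * 2\<close>.\<close>

lemma round_cost_le:
  assumes p: "1 \<le> p" and nz: "nnz A \<noteq> 0"
  shows "real (round_cost A p) \<le> 125 * (real (nnz A) + real (dim_row A) * ln p)"
proof -
  let ?R = "length (nz_rows A)"
  have l0: "0 \<le> log 2 (1 + p)" using p by simp
  have "real (pow_cost p) = of_int \<lceil>log 2 (1 + p)\<rceil>" using l0 by (simp add: pow_cost_def)
  also have "\<dots> \<le> log 2 (1 + p) + 1" by linarith
  also have "log 2 (1 + p) \<le> log 2 (2 * p)" using p by simp
  also have "\<dots> = 1 + log 2 p" using p by (simp add: log_mult)
  also have "log 2 p \<le> 2 * ln p"
  proof -
    have "ln p * 1 \<le> ln p * (2 * ln 2)" using p two_ln_2_ge_1 by (intro mult_left_mono) auto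
    then show ?thesis by (simp add: log_def field_simps)
  qed
  finally have "real (pow_cost p) \<le> 2 + 2 * ln p" by simp
  then have "real ?R * real (pow_cost p) \<le> real ?R * (2 + 2 * ln p)" by (intro mult_left_mono) auto
  also have "\<dots> = 2 * real ?R + 2 * (real ?R * ln p)" by (simp add: algebra_simps)
  also have "\<dots> \<le> 2 * real (nnz A) + 2 * (real (dim_row A) * ln p)"
    using length_nz_rows_le_nnz[of A] length_nz_rows_le_dim[of A] p
    by (intro add_mono mult_left_mono mult_right_mono) auto
  finally have "real ?R * real (pow_cost p) \<le> 2 * real (nnz A) + 2 * (real (dim_row A) * ln p)" .
  moreover have "0 \<le> real (dim_row A) * ln p" using p by simp
  ultimately show ?thesis using nz by (simp add: round_cost_def)
qed

text \<open>The invariant carries the number of completed rounds, and the test can succeed only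
  while this number is below \<open>K\<close>. Hence \<open>K - k\<close> decreases, and termination
  comes together with the invariant for the exact number of rounds.\<close>

lemma while_option_bounded:
  fixes Q :: "nat \<Rightarrow> 's \<Rightarrow> bool"
  assumes init: "Q 0 s" and pres: "\<And>k s. Q k s \<Longrightarrow> b s \<Longrightarrow> Q (Suc k) (c s)"
    and bound: "\<And>k s. Q k s \<Longrightarrow> b s \<Longrightarrow> k < K"
  shows "\<exists>k s'. k \<le> K \<and> while_option b c s = Some s' \<and> Q k s' \<and> \<not> b s'"
proof -
  have "\<exists>k s'. k \<le> K \<and> while_option b c s = Some s' \<and> Q k s' \<and> \<not> b s'" if "Q j s" "j \<le> K" for j s
    using that
  proof (induction "K - j" arbitrary: j s rule: less_induct)
    case less
    show ?case
    proof (cases "b s")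
      case True
      then have "j < K" using bound less.prems by blast
      then have "\<exists>k s'. k \<le> K \<and> while_option b c (c s) = Some s' \<and> Q k s' \<and> \<not> b s'"
        using pres[OF less.prems(1) True] by (intro less.hyps) auto
      then show ?thesis using True by (simp add: while_option_unfold[of b c s])
    next
      case False
      then show ?thesis using less.prems by (auto simp: while_option_unfold[of b c s])
    qed
  qed
  then show ?thesis using init by blast
qed

section \<open>The timed loop\<close>

context norm_problem
begin

definition powers :: "real vec \<Rightarrow> real vec" where
  "powers x = vec n (\<lambda>k. x $ k powr (q - 1))"

definition start :: "real vec" where
  "start = vec n (\<lambda>_. real n powr (- 1 / q))"

definition testT :: "state \<Rightarrow> bool timed" where
  "testT = condT m (sparse_rows A) q p ((1 - \<epsilon>) * V)"

definition roundT :: "state \<Rightarrow> state timed" where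
  "roundT = bodyT m n (sparse_rows A) (sparse_cols A) q p (\<epsilon> / 8) ((1 + \<epsilon> / 8) powr (q - 1))
     ((1 + \<epsilon> / 8) powr q - 1) (((1 - \<epsilon> / 4) * V) powr q) (V powr q)"

text \<open>Lets the sparse loops ignore empty columns: for positive \<open>V\<close> they are
  neither active nor an obstacle to reporting infeasibility.\<close>

lemma potential_not_nz_col:
  assumes "k < n" "k \<notin> set (nz_rows (transpose_mat A))"
  shows "potential q p A x $ k = 0"
proof -
  have "(transpose_mat A *\<^sub>v vec_powr (A *\<^sub>v x) (p - 1)) $ k = 0"
    by (rule mult_mat_vec_not_nz_row) (use assms in \<open>auto simp: vec_powr_def\<close>)
  then show ?thesis using assms by (simp add: potential_def)
qed

lemma val_testT:
  assumes x: "positive x"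
  shows "val (testT (x, u, mass x, b)) \<longleftrightarrow> \<not> b \<and> pnorm p (A *\<^sub>v x) / pnorm q x < (1 - \<epsilon>) * V"
proof -
  have dx: "dim_vec x = dim_col A" using positive_carrier[OF x] by simp
  have v1: "val (mat_vecT m (sparse_rows A) x) = A *\<^sub>v x" by (rule val_mat_vecT) (use dx in auto)
  have v2: "val (pnormT p (sparse_rows A) (A *\<^sub>v x)) = pnorm p (A *\<^sub>v x)"
    by (rule val_pnormT) (use mult_positive_nonneg[OF x] mult_mat_vec_not_nz_row[OF _ dx] in
        \<open>auto simp: carrier_vecI simp del: index_mult_mat_vec\<close>)
  show ?thesis by (simp add: testT_def condT_def v1 v2 pnorm_eq_mass[OF x])
qed

text \<open>For \<open>V = 0\<close> the test compares a nonnegative quotient with 0 and fails.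
  Every executed round may thus assume positive thresholds.\<close>

lemma test_imp_V_pos:
  assumes "pnorm p (A *\<^sub>v x) / pnorm q x < (1 - \<epsilon>) * V"
  shows "0 < V"
proof (rule ccontr)
  assume "\<not> 0 < V"
  then have "V = 0" using V_nonneg by simp
  moreover have "0 \<le> pnorm p (A *\<^sub>v x) / pnorm q x" by (simp add: pnorm_nonneg)
  ultimately show False using assms by simp
qed

lemma val_roundT:
  assumes x: "positive x" and V: "0 < V"
  shows "val (roundT (x, powers x, mass x, b)) = (step x, powers (step x), mass (step x),
    \<forall>i<n. potential q p A (step x) $ i < V powr q)"
proof -
  let ?ks = "nz_rows (transpose_mat A)" and ?f = "potential q p A x"
  let ?thr = "((1 - \<epsilon> / 4) * V) powr q" and ?c = "1 + \<epsilon> / 8"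
  have thr: "0 < ?thr" using V eps_le_half by simp
  have ks: "distinct ?ks" "set ?ks \<subseteq> {..<n}" by (auto simp: distinct_nz_rows set_nz_rows)
  \<comment> \<open>A column outside the list has potential 0, strictly below the positive
    threshold.\<close>
  have act: "k \<in> set ?ks \<and> ?thr \<le> ?f $ k \<longleftrightarrow> k \<in> active x" if "k < n" for k
    using that thr potential_not_nz_col[OF that, of x] unfolding active_def
    by (metis (mono_tags, lifting) mem_Collect_eq not_less)
  have Act: "{k. k \<in> set ?ks \<and> ?thr \<le> ?f $ k} = active x"
    using act active_less ks by blast
  have cols: "sparse_cols A = map (\<lambda>k. (k, row_entries (transpose_mat A) k)) ?ks"
    by (simp add: sparse_cols_def sparse_rows_eq)
  note xc = positive_carrier[OF x] and sc = positive_carrier[OF positive_step[OF x]]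
  have f: "val (potentialT m n (sparse_rows A) (sparse_cols A) q p x (powers x)) = ?f"
    unfolding powers_def using carrier xc mult_positive_nonneg[OF x] by (rule val_potentialT)
  have f': "val (potentialT m n (sparse_rows A) (sparse_cols A) q p (step x) (powers (step x)))
      = potential q p A (step x)"
    unfolding powers_def using carrier sc mult_positive_nonneg[OF positive_step[OF x]]
    by (rule val_potentialT)
  have "val (updateT (sparse_cols A) (\<epsilon> / 8) (?c powr (q - 1)) (?c powr q - 1) ?thr ?f (x, powers x, mass x))
      = (step x, powers (step x), mass (step x))"
  proof -
    have "vec n (\<lambda>k. if k \<in> set ?ks \<and> ?thr \<le> ?f $ k then x $ k + \<epsilon> / 8 * x $ k else x $ k) = step x"
      by (rule eq_vecI) (use sc act step_index[OF xc] in \<open>auto simp: algebra_simps\<close>)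
    moreover have "vec n (\<lambda>k. if k \<in> set ?ks \<and> ?thr \<le> ?f $ k then ?c powr (q - 1) * powers x $ k
        else powers x $ k) = powers (step x)"
      by (rule eq_vecI) (use act step_index[OF xc] in \<open>auto simp: powers_def powr_mult\<close>)
    moreover have "mass x + (\<Sum>k | k \<in> set ?ks \<and> ?thr \<le> ?f $ k. (?c powr q - 1) * (x $ k * powers x $ k))
        = mass (step x)"
    proof -
      \<comment> \<open>Multiplying the maintained power by the entry recovers the q-th power, so
        \<open>D\<close> stays equal to the mass.\<close>
      have "x $ k * powers x $ k = x $ k powr q" if "k \<in> active x" for k
        using active_less[OF that] positive_gt_0[OF x active_less[OF that]]
          powr_mult_base[of "x $ k" "q - 1"] by (simp add: powers_def)
      then show ?thesis
        unfolding Act mass_step[OF x] sum_distrib_left by simp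
    qed
    ultimately show ?thesis
      unfolding cols by (subst val_updateT[OF ks(1) xc _ ks(2)]) (auto simp: powers_def)
  qed
  moreover have "(\<forall>k\<in>set ?ks. potential q p A (step x) $ k < V powr q)
      \<longleftrightarrow> (\<forall>i<n. potential q p A (step x) $ i < V powr q)"
    using ks(2) potential_not_nz_col[of _ "step x"] V by (metis lessThan_iff powr_gt_zero subset_iff
        less_irrefl)
  ultimately show ?thesis
    by (simp add: roundT_def bodyT_def f f') (simp add: cols val_infeasibleT)
qed

section \<open>The invariant of the timed loop\<close>

lemma time_test_round: "time (testT s) + time (roundT s') \<le> round_cost A p"
  unfolding testT_def roundT_def by (rule time_round[OF p1])

text \<open>State after \<open>k\<close> rounds. The initial flag is set without looking at
  potentials, hence the restriction \<open>0 < k\<close> for the existence of a large potential.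
  Coordinates with large potential have been scaled in all \<open>k\<close> rounds, so their value
  is known exactly. The summand 18 pays for the setup.\<close>

definition reached :: "nat \<Rightarrow> state timed \<Rightarrow> bool" where
  "reached k S \<longleftrightarrow> (\<exists>x b. val S = (x, powers x, mass x, b) \<and> positive x \<and>
     rate * (mass x - 1) \<le> pnorm p (A *\<^sub>v x) powr q \<and>
     (b \<longrightarrow> (\<forall>i<n. potential q p A x $ i < V powr q)) \<and>
     (\<not> b \<longrightarrow> 0 < k \<longrightarrow> (\<exists>i<n. V powr q \<le> potential q p A x $ i)) \<and>
     (\<forall>i<n. V powr q \<le> potential q p A x $ i \<longrightarrow>
        x $ i = (1 + \<epsilon> / 8) ^ k * real n powr (- 1 / q)) \<and>
     time S \<le> 18 + k * round_cost A p)"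

lemma positive_start: "positive start"
  using n_pos by (auto simp: positive_def start_def)

lemma mass_start: "mass start = 1"
proof -
  have "mass start = real n * (real n powr (- 1 / q)) powr q" by (simp add: mass_def start_def)
  also have "\<dots> = real n * real n powr (- 1)" using q_ge_1 by (simp add: powr_powr)
  finally show ?thesis using n_pos by (simp add: powr_minus)
qed

lemma reached_start: "reached 0 (Timed (start, powers start, 1, False) 18)"
  unfolding reached_def
  by (intro exI[of _ start] exI[of _ False])
    (auto simp: mass_start positive_start, simp add: start_def)

lemma reached_round:
  assumes R: "reached k S" and test: "val (testT (val S))"
  shows "reached (Suc k) (Timed (val (roundT (val S))) (time S + time (testT (val S)) + time (roundT (val S))))"
proof -
  from R obtain x b where S: "val S = (x, powers x, mass x, b)" and x: "positive x"
    and inv: "rate * (mass x - 1) \<le> pnorm p (A *\<^sub>v x) powr q"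
    and scaled: "\<And>i. i < n \<Longrightarrow> V powr q \<le> potential q p A x $ i \<Longrightarrow>
        x $ i = (1 + \<epsilon> / 8) ^ k * real n powr (- 1 / q)"
    and t: "time S \<le> 18 + k * round_cost A p"
    by (auto simp: reached_def)
  have V: "0 < V" using test unfolding S val_testT[OF x] by (auto intro: test_imp_V_pos)
  have "rate * (mass (step x) - 1) \<le> pnorm p (A *\<^sub>v step x) powr q"
    using inv growth_step[OF x] by (simp add: algebra_simps)
  \<comment> \<open>A large potential after the round was large before it and belonged to an active
    coordinate: the old formula gains one factor.\<close>
  moreover have "step x $ i = (1 + \<epsilon> / 8) ^ Suc k * real n powr (- 1 / q)"
    if i: "i < n" and ge: "V powr q \<le> potential q p A (step x) $ i" for i
    using potential_step_ge[OF x i V ge] scaled[OF i] step_index[OF positive_carrier[OF x] i]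
    by simp
  moreover have "time S + time (testT (val S)) + time (roundT (val S)) \<le> 18 + Suc k * round_cost A p"
    using t time_test_round[of "val S" "val S"] by simp
  ultimately show ?thesis
    unfolding reached_def S val_roundT[OF x V] using positive_step[OF x]
    by (intro exI[of _ "step x"] exI[of _ "\<forall>i<n. potential q p A (step x) $ i < V powr q"])
      (auto simp: not_less)
qed

section \<open>Number of rounds and total cost\<close>

definition max_rounds :: nat where
  "max_rounds = (if nnz A = 0 then 1
     else nat \<lceil>48 * (1 / (q * \<epsilon>) * ln (real n / (q * \<epsilon>)))\<rceil>)"

lemma rounds_factor_ge_1: "1 \<le> 1 / (q * \<epsilon>) * ln (real n / (q * \<epsilon>))"
proof -
  have a: "2 \<le> 1 / (q * \<epsilon>)" using q_eps by (simp add: field_simps)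
  have "1 / (q * \<epsilon>) \<le> real n / (q * \<epsilon>)" using n_pos q_eps by (intro divide_right_mono) auto
  with a have "2 \<le> real n / (q * \<epsilon>)" by linarith
  then have b: "ln 2 \<le> ln (real n / (q * \<epsilon>))" by (subst ln_le_cancel_iff) auto
  have "2 * ln 2 \<le> 1 / (q * \<epsilon>) * ln (real n / (q * \<epsilon>))"
    by (rule mult_mono[OF a b]) (use q_eps in auto)
  then show ?thesis using two_ln_2_ge_1 by linarith
qed

text \<open>A successful test after \<open>k > 0\<close> rounds has the flag unset, which yields a
  coordinate scaled \<open>k\<close> times; the same test bounds the mass. Both together limit
  \<open>k\<close>.\<close>

lemma reached_less_max_rounds:
  assumes R: "reached k S" and test: "val (testT (val S))"
  shows "k < max_rounds"
proof -
  from R obtain x b where S: "val S = (x, powers x, mass x, b)" and x: "positive x"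
    and inv: "rate * (mass x - 1) \<le> pnorm p (A *\<^sub>v x) powr q"
    and ex: "\<not> b \<Longrightarrow> 0 < k \<Longrightarrow> \<exists>i<n. V powr q \<le> potential q p A x $ i"
    and scaled: "\<And>i. i < n \<Longrightarrow> V powr q \<le> potential q p A x $ i \<Longrightarrow>
        x $ i = (1 + \<epsilon> / 8) ^ k * real n powr (- 1 / q)"
    unfolding reached_def by metis
  have b: "\<not> b" and cond: "pnorm p (A *\<^sub>v x) / pnorm q x < (1 - \<epsilon>) * V"
    using test val_testT[OF x] by (auto simp: S)
  have V: "0 < V" by (rule test_imp_V_pos[OF cond])
  have pos: "0 < max_rounds"
    using rounds_factor_ge_1 by (simp add: max_rounds_def)
  show ?thesis
  proof (cases "k = 0")
    case True
    then show ?thesis using pos by simp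
  next
    case False
    then obtain i where i: "i < n" "V powr q \<le> potential q p A x $ i" using ex[OF b] by auto
    \<comment> \<open>For a zero matrix all potentials vanish, so the first round already reports
      infeasibility.\<close>
    have "nnz A \<noteq> 0"
    proof
      assume "nnz A = 0"
      then have "nz_rows (transpose_mat A) = []"
        using length_nz_rows_le_nnz[of "transpose_mat A"] by (simp add: nnz_transpose)
      then have "potential q p A x $ i = 0" using potential_not_nz_col[OF i(1)] by simp
      then show False using i V by simp
    qed
    moreover have "real k < 48 * (1 / (q * \<epsilon>) * ln (real n / (q * \<epsilon>)))"
      using x i(1) scaled[OF i] mass_bound[OF x V inv cond] by (rule iteration_bound)
    ultimately show ?thesis
      unfolding max_rounds_def by (simp add: nat_less_iff zless_nat_eq_int_zless less_ceiling_iff)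
  qed
qed

text \<open>\<open>Suc k\<close> charges the final failing test as a full round. For
  \<open>A\<close> with a nonzero entry, \<open>Suc k \<le> 48 * F + 2 \<le> 50 * F\<close>, and the
  setup is absorbed by \<open>F * G \<ge> 1\<close>:
  \<open>50 * 125 + 18 \<le> 6300\<close>.\<close>

lemma total_cost_le:
  assumes k: "k \<le> max_rounds"
  shows "real (18 + Suc k * round_cost A p)
    \<le> 6300 * max 1 (1 / (q * \<epsilon>) * ln (real n / (q * \<epsilon>)) * (real (nnz A) + real m * ln p))"
proof (cases "nnz A = 0")
  case True
  then have "Suc k * round_cost A p \<le> 2 * 37"
    using k by (intro mult_mono) (auto simp: max_rounds_def round_cost_def)
  then have "18 + Suc k * round_cost A p \<le> 6300 * 1" by simp
  then have "real (18 + Suc k * round_cost A p) \<le> 6300 * 1" by linarith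
  also have "\<dots> \<le> 6300 * max 1 (1 / (q * \<epsilon>) * ln (real n / (q * \<epsilon>)) * (real (nnz A) + real m * ln p))"
    by (intro mult_left_mono) auto
  finally show ?thesis .
next
  case False
  define F where "F = 1 / (q * \<epsilon>) * ln (real n / (q * \<epsilon>))"
  define G where "G = real (nnz A) + real m * ln p"
  have F: "1 \<le> F" unfolding F_def by (rule rounds_factor_ge_1)
  have "0 \<le> real m * ln p" using p1 by simp
  then have G: "1 \<le> G" using False unfolding G_def by linarith
  have "real k \<le> real (nat \<lceil>48 * F\<rceil>)" using k False by (simp add: max_rounds_def F_def)
  also have "\<dots> \<le> 48 * F + 1" using F by linarith
  finally have "real (Suc k) \<le> 50 * F" using F by simp
  moreover have "real (round_cost A p) \<le> 125 * G"
    using round_cost_le[OF p1 False] by (simp add: G_def)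
  ultimately have "real (Suc k) * real (round_cost A p) \<le> (50 * F) * (125 * G)"
    using F by (intro mult_mono) auto
  moreover have "1 * 1 \<le> F * G" using F G by (intro mult_mono) auto
  ultimately have "real (18 + Suc k * round_cost A p) \<le> 6300 * (F * G)"
    unfolding of_nat_add of_nat_mult by simp
  also have "\<dots> \<le> 6300 * max 1 (F * G)" by simp
  finally show ?thesis by (simp only: F_def G_def)
qed

section \<open>Transfer to the untimed algorithm and conclusion\<close>

lemma norm_algT_eq:
  "norm_algT A V \<epsilon> q p = map_option
     (\<lambda>R. case val R of (x, _, _, infeasible) \<Rightarrow>
        Timed (if infeasible then Infeasible else Returned x) (time R))
     (whileT testT roundT (Timed (start, powers start, 1, False) 18))"
proof -
  have "powers start = vec n (\<lambda>_. (real n powr (- 1 / q)) powr (q - 1))"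
    by (auto simp: powers_def start_def vec_eq_iff)
  then have "val (setupT n V \<epsilon> q) = (\<epsilon> / 8, (1 + \<epsilon> / 8) powr (q - 1), (1 + \<epsilon> / 8) powr q - 1,
      ((1 - \<epsilon> / 4) * V) powr q, V powr q, (1 - \<epsilon>) * V, start, powers start)"
    by (simp add: setupT_def start_def)
  moreover have "time (setupT n V \<epsilon> q) = 18" by (simp add: setupT_def)
  ultimately show ?thesis
    by (simp add: norm_algT_def Let_def testT_def roundT_def)
qed

text \<open>Only the timed loop is analysed. The untimed one is its image under \<open>proj\<close>,
  which forgets the clock, \<open>u\<close> and \<open>D\<close>.\<close>

lemma norm_alg_correct:
  "\<exists>r t.
     norm_alg A V \<epsilon> q p = Some r \<and>
     (case r of
        Returned x \<Rightarrow> x \<in> carrier_vec n \<and> x \<noteq> 0\<^sub>v n \<and>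
          pnorm p (A *\<^sub>v x) / pnorm q x \<ge> (1 - \<epsilon>) * V
      | Infeasible \<Rightarrow> op_norm q p A < V) \<and>
     norm_algT A V \<epsilon> q p = Some (Timed r t) \<and>
     real t \<le> 6300 * max 1 (1 / (q * \<epsilon>) * ln (real n / (q * \<epsilon>)) *
                          (real (nnz A) + real m * ln p))"
proof -
  define s0 :: "state timed" where "s0 = Timed (start, powers start, 1, False) 18"
  define tst where "tst S = val (testT (val S))" for S :: "state timed"
  define rnd where "rnd S = Timed (val (roundT (val S)))
    (time S + time (testT (val S)) + time (roundT (val S)))" for S
  define proj where "proj S = (case val S of (x, u, D, b) \<Rightarrow> (x, b))" for S :: "state timed"
  have init: "reached 0 s0" unfolding s0_def by (rule reached_start)
  have pres: "reached (Suc k) (rnd S)" if "reached k S" "tst S" for k S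
    unfolding rnd_def using reached_round that by (simp add: tst_def)
  obtain k S where k: "k \<le> max_rounds" and loop: "while_option tst rnd s0 = Some S"
    and R: "reached k S" and stop: "\<not> tst S"
    using while_option_bounded[of reached s0 tst rnd max_rounds] init pres reached_less_max_rounds
    unfolding tst_def by blast
  from R obtain x b where S: "val S = (x, powers x, mass x, b)" and x: "positive x"
    and inf: "b \<Longrightarrow> \<forall>i<n. potential q p A x $ i < V powr q"
    and t: "time S \<le> 18 + k * round_cost A p"
    unfolding reached_def by metis
  define r where "r = (if b then Infeasible else Returned x)"
  have sim: "map_option proj (while_option tst rnd s0) = while_option
          (\<lambda>(x, infeasible).
             \<not> infeasible \<and> pnorm p (A *\<^sub>v x) / pnorm q x < (1 - \<epsilon>) * V)
          (\<lambda>(x, _).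
             let x' = x + delta A V \<epsilon> q p x
             in (x', \<forall>i<dim_col A. potential q p A x' $ i < V powr q))
          (proj s0)"
  \<comment> \<open>The projection commutes with test and body only on reachable states, where
    \<open>u\<close> and \<open>D\<close> hold the intended values.\<close>
  proof (rule while_option_commute_invariant[where P = "\<lambda>S. \<exists>k. reached k S"])
    show "\<exists>k. reached k s0" using init by blast
    show "\<exists>k. reached k (rnd S)" if "\<exists>k. reached k S" "tst S" for S using pres that by blast
    show "tst S = (case proj S of (x, infeasible) \<Rightarrow>
        \<not> infeasible \<and> pnorm p (A *\<^sub>v x) / pnorm q x < (1 - \<epsilon>) * V)" if "\<exists>k. reached k S" for S
      using that val_testT by (auto simp: reached_def tst_def proj_def)
    show "proj (rnd S) = (case proj S of (x, _) \<Rightarrow> let x' = x + delta A V \<epsilon> q p x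
        in (x', \<forall>i<dim_col A. potential q p A x' $ i < V powr q))"
      if R: "\<exists>k. reached k S" and T: "tst S" for S
    proof -
      from R obtain x b where S: "val S = (x, powers x, mass x, b)" and x: "positive x"
        by (auto simp: reached_def)
      have "0 < V" using T unfolding tst_def S val_testT[OF x] by (auto intro: test_imp_V_pos)
      then show ?thesis by (simp add: rnd_def proj_def S val_roundT[OF x] step_def Let_def)
    qed
  qed
  have proj_s0: "(vec (dim_col A) (\<lambda>_. real (dim_col A) powr (- 1 / q)), False) = proj s0"
    by (simp add: proj_def s0_def start_def)
  have "norm_alg A V \<epsilon> q p = Some r"
    unfolding norm_alg_def proj_s0 sim[symmetric] by (simp add: loop proj_def S r_def)
  moreover have "norm_algT A V \<epsilon> q p = Some (Timed r (time S + time (testT (val S))))"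
    using loop by (simp add: norm_algT_eq whileT_def tst_def[abs_def] rnd_def[abs_def] s0_def S r_def)
  moreover have "real (time S + time (testT (val S))) \<le> 6300 * max 1
      (1 / (q * \<epsilon>) * ln (real n / (q * \<epsilon>)) * (real (nnz A) + real m * ln p))"
  proof -
    have "time S + time (testT (val S)) \<le> 18 + Suc k * round_cost A p"
      using t time_test_round[of "val S" "val S"] by simp
    then have "real (time S + time (testT (val S))) \<le> real (18 + Suc k * round_cost A p)"
      by (simp only: of_nat_le_iff)
    also note total_cost_le[OF k]
    finally show ?thesis .
  qed
  moreover have "case r of
        Returned x \<Rightarrow> x \<in> carrier_vec n \<and> x \<noteq> 0\<^sub>v n \<and>
          pnorm p (A *\<^sub>v x) / pnorm q x \<ge> (1 - \<epsilon>) * V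
      | Infeasible \<Rightarrow> op_norm q p A < V"
  proof (cases b)
    case True
    then show ?thesis using op_norm_less[OF n_pos x _ V_nonneg] inf by (simp add: r_def)
  next
    case False
    then have "(1 - \<epsilon>) * V \<le> pnorm p (A *\<^sub>v x) / pnorm q x"
      using stop val_testT[OF x] by (simp add: tst_def S)
    moreover have "x \<noteq> 0\<^sub>v n" using positive_gt_0[OF x n_pos] n_pos by auto
    ultimately show ?thesis using False positive_carrier[OF x] by (simp add: r_def)
  qed
  ultimately show ?thesis by blast
qed

end

theorem theorem11:
  "\<exists>C::real. \<forall>(m::nat) (n::nat) (A::real mat) (p::real) (q::real) (\<epsilon>::real) (V::real).
     0 < m \<longrightarrow> 0 < n \<longrightarrow> A \<in> carrier_mat m n \<longrightarrow>
     (\<forall>i<m. \<forall>j<n. 0 \<le> A $$ (i, j)) \<longrightarrow>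
     1 \<le> p \<longrightarrow> p \<le> q \<longrightarrow> 0 < \<epsilon> \<longrightarrow> \<epsilon> \<le> 1 / (2 * q) \<longrightarrow> 0 \<le> V \<longrightarrow>
     (\<exists>r t.
        norm_alg A V \<epsilon> q p = Some r \<and>
        (case r of
           Returned x \<Rightarrow> x \<in> carrier_vec n \<and> x \<noteq> 0\<^sub>v n \<and>
             pnorm p (A *\<^sub>v x) / pnorm q x \<ge> (1 - \<epsilon>) * V
         | Infeasible \<Rightarrow> op_norm q p A < V) \<and>
        norm_algT A V \<epsilon> q p = Some (Timed r t) \<and>
        real t \<le> C * max 1 (1 / (q * \<epsilon>) * ln (real n / (q * \<epsilon>)) *
                             (real (nnz A) + real m * ln p)))"
proof (intro exI[of _ "6300 :: real"] allI impI)
  fix m n :: nat and A :: "real mat" and p q \<epsilon> V :: real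
  assume "0 < n" "A \<in> carrier_mat m n" "\<forall>i<m. \<forall>j<n. 0 \<le> A $$ (i, j)"
    "1 \<le> p" "p \<le> q" "0 < \<epsilon>" "\<epsilon> \<le> 1 / (2 * q)" "0 \<le> V"
  then interpret norm_problem A m n p q \<epsilon> V
    by unfold_locales auto
  show "\<exists>r t.
        norm_alg A V \<epsilon> q p = Some r \<and>
        (case r of
           Returned x \<Rightarrow> x \<in> carrier_vec n \<and> x \<noteq> 0\<^sub>v n \<and>
             pnorm p (A *\<^sub>v x) / pnorm q x \<ge> (1 - \<epsilon>) * V
         | Infeasible \<Rightarrow> op_norm q p A < V) \<and>
        norm_algT A V \<epsilon> q p = Some (Timed r t) \<and>
        real t \<le> 6300 * max 1 (1 / (q * \<epsilon>) * ln (real n / (q * \<epsilon>)) *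
                             (real (nnz A) + real m * ln p))"
    by (rule norm_alg_correct)
qed

end
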